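(* Let $G_m$ be a bounded Vilenkin group, let $p\in[1,\infty]$ and $\alpha\in(0,1)$. Then there is a constant $c(p,\alpha)$ (independent of $f$, $n$ and $k$) such that for every $f\in L^p(G_m)$, every integer $k\ge 1$ and every integer $n$ with $M_k\le n<M_{k+1}$, $$\left\|\sigma_n^{-\alpha}(f)-f\right\|_p\le c(p,\alpha)\left\{M_k^{\alpha}\,\omega\left(1/M_{k-1},f\right)_p+\sum_{r=0}^{k-2}\frac{M_r}{M_k}\,\omega\left(1/M_r,f\right)_p\right\},$$ where for $k=1$ the sum is empty and equals $0$.
   Context: Let $m=(m_0,m_1,\dots)$ be a fixed bounded sequence of integers $m_k\ge 2$, and $Z_{m_k}=\{0,1,\dots,m_k-1\}$ the additive group of integers modulo $m_k$ with the discrete topology. The bounded Vilenkin group $G_m$ is the complete direct product of the groups $Z_{m_k}$ ($k\in N=\{0,1,2,\dots\}$) with the product topology and coordinatewise addition; $\mu$ is its Haar measure with $\mu(G_m)=1$ (the product of the uniform probability measures on $Z_{m_k}$). Elements are written $x=(x_0,x_1,\dots)$, $x_j\in Z_{m_j}$. Constants may depend on the fixed sequence $m$. Put $I_0=G_m$ and $I_n=\{y\in G_m: y_0=\dots=y_{n-1}=0\}$ for $n\ge1$. Put $M_0=1$, $M_{k+1}=m_kM_k$; every $n\in N$ is uniquely $n=\sum_{j=0}^\infty n_jM_j$ with $n_j\in Z_{m_j}$, only finitely many $n_j$ nonzero. The generalized Rademacher functions are $r_k(x)=\exp(2\pi i x_k/m_k)$, and the Vilenkin system is $\psi_n(x)=\prod_{k=0}^\infty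 r_k(x)^{n_k}$, $n\in N$. Fourier coefficients: $\widehat f(k)=\int_{G_m} f\,\overline{\psi_k}\,d\mu$. For real $\beta$, $A_0^{\beta}=1$ and $A_n^{\beta}=\frac{(\beta+1)\cdots(\beta+n)}{n!}$ for $n\ge1$. The Cesàro $(C,-\alpha)$ means of the Vilenkin-Fourier series of $f$ are $$\sigma_n^{-\alpha}(f,x)=\frac1{A_n^{-\alpha}}\sum_{k=0}^n A_{n-k}^{-\alpha}\widehat f(k)\psi_k(x).$$ For $1\le p<\infty$, $\|f\|_p=\left(\int_{G_m}|f|^p\,d\mu\right)^{1/p}$. By convention $L^\infty(G_m)$ denotes $C(G_m)$, the continuous functions on $G_m$ with the supremum norm $\|\cdot\|_\infty$. The modulus of continuity is $\omega(1/M_n,f)_p=\sup_{h\in I_n}\|f(\cdot+h)-f(\cdot)\|_p$. *)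

theory Defs
  imports "HOL-Probability.Probability"
begin

text \<open>Throughout, \<open>m\<close> is the sequence generating the Vilenkin group. Elements of the group are
  functions \<open>x :: nat \<Rightarrow> nat\<close> with \<open>x k < m k\<close> for all \<open>k\<close>.\<close>

definition vilenkin_topology :: "(nat \<Rightarrow> nat) \<Rightarrow> (nat \<Rightarrow> nat) topology" where
  "vilenkin_topology m = product_topology (\<lambda>k. discrete_topology {..<m k}) UNIV"

definition vilenkin_measure :: "(nat \<Rightarrow> nat) \<Rightarrow> (nat \<Rightarrow> nat) measure" where
  "vilenkin_measure m = PiM UNIV (\<lambda>k. uniform_count_measure {..<m k})"

definition vilenkin_group :: "(nat \<Rightarrow> nat) \<Rightarrow> (nat \<Rightarrow> nat) set" where
  "vilenkin_group m = (\<Pi>\<^sub>E k\<in>UNIV. {..<m k})"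

lemma topspace_vilenkin_topology: "topspace (vilenkin_topology m) = vilenkin_group m"
  by (simp add: vilenkin_topology_def vilenkin_group_def)

lemma space_vilenkin_measure: "space (vilenkin_measure m) = vilenkin_group m"
  by (simp add: vilenkin_measure_def vilenkin_group_def space_PiM space_uniform_count_measure)

definition vilenkin_add :: "(nat \<Rightarrow> nat) \<Rightarrow> (nat \<Rightarrow> nat) \<Rightarrow> (nat \<Rightarrow> nat) \<Rightarrow> (nat \<Rightarrow> nat)" where
  "vilenkin_add m x y = (\<lambda>k. (x k + y k) mod m k)"

definition vilenkin_I :: "(nat \<Rightarrow> nat) \<Rightarrow> nat \<Rightarrow> (nat \<Rightarrow> nat) set" where
  "vilenkin_I m n = {y \<in> vilenkin_group m. \<forall>j<n. y j = 0}"

definition vilenkin_M :: "(nat \<Rightarrow> nat) \<Rightarrow> nat \<Rightarrow> nat" where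
  "vilenkin_M m k = (\<Prod>j<k. m j)"

lemma vilenkin_M_rec: "vilenkin_M m 0 = 1" "vilenkin_M m (Suc k) = m k * vilenkin_M m k"
  by (simp_all add: vilenkin_M_def)

definition vilenkin_digit :: "(nat \<Rightarrow> nat) \<Rightarrow> nat \<Rightarrow> nat \<Rightarrow> nat" where
  "vilenkin_digit m n j = (n div vilenkin_M m j) mod m j"

lemma vilenkin_digit_expansion:
  assumes "n < vilenkin_M m k"
  shows "n = (\<Sum>j<k. vilenkin_digit m n j * vilenkin_M m j)"
proof -
  have "n mod vilenkin_M m k = (\<Sum>j<k. vilenkin_digit m n j * vilenkin_M m j)"
  proof (induction k)
    case (Suc k)
    have "n mod vilenkin_M m (Suc k)
        = vilenkin_M m k * (n div vilenkin_M m k mod m k) + n mod vilenkin_M m k"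
      by (metis mod_mult2_eq mult.commute vilenkin_M_rec(2))
    with Suc show ?case
      by (simp add: vilenkin_digit_def mult.commute)
  qed (simp add: vilenkin_M_def)
  with assms show ?thesis by simp
qed

definition vilenkin_r :: "(nat \<Rightarrow> nat) \<Rightarrow> nat \<Rightarrow> (nat \<Rightarrow> nat) \<Rightarrow> complex" where
  "vilenkin_r m k x = exp (2 * of_real pi * \<i> * of_nat (x k) / of_nat (m k))"

text \<open>If all \<open>m k \<ge> 2\<close>, the index set below is finite; the omitted factors are all 1.\<close>

definition vilenkin_psi :: "(nat \<Rightarrow> nat) \<Rightarrow> nat \<Rightarrow> (nat \<Rightarrow> nat) \<Rightarrow> complex" where
  "vilenkin_psi m n x =
     (\<Prod>k | vilenkin_digit m n k \<noteq> 0. vilenkin_r m k x ^ vilenkin_digit m n k)"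

lemma finite_vilenkin_digit_support:
  assumes "\<And>k. 2 \<le> m k"
  shows "finite {k. vilenkin_digit m n k \<noteq> 0}"
proof (rule finite_subset)
  have M: "k < vilenkin_M m k" for k
  proof (induction k)
    case (Suc k)
    have "2 * vilenkin_M m k \<le> vilenkin_M m (Suc k)"
      using assms[of k] by (simp add: vilenkin_M_rec)
    with Suc show ?case by linarith
  qed (simp add: vilenkin_M_def)
  show "{k. vilenkin_digit m n k \<noteq> 0} \<subseteq> {..n}"
  proof
    fix k assume k: "k \<in> {k. vilenkin_digit m n k \<noteq> 0}"
    have "\<not> n < k"
    proof
      assume "n < k"
      then have "n < vilenkin_M m k" using M[of k] by simp
      then show False using k by (simp add: vilenkin_digit_def)
    qed
    then show "k \<in> {..n}" by simp
  qed
qed simp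

definition vilenkin_fourier :: "(nat \<Rightarrow> nat) \<Rightarrow> ((nat \<Rightarrow> nat) \<Rightarrow> complex) \<Rightarrow> nat \<Rightarrow> complex" where
  "vilenkin_fourier m f k = (LINT x|vilenkin_measure m. f x * cnj (vilenkin_psi m k x))"

definition cesaro_A :: "real \<Rightarrow> nat \<Rightarrow> real" where
  "cesaro_A \<beta> n = (\<Prod>j=1..n. \<beta> + real j) / fact n"

text \<open>These are the $(C,\beta)$ means; negative \<open>\<beta>\<close> is allowed.\<close>

definition cesaro_mean ::
  "(nat \<Rightarrow> nat) \<Rightarrow> real \<Rightarrow> nat \<Rightarrow> ((nat \<Rightarrow> nat) \<Rightarrow> complex) \<Rightarrow> (nat \<Rightarrow> nat) \<Rightarrow> complex" where
  "cesaro_mean m \<beta> n f x =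
     (\<Sum>k\<le>n. of_real (cesaro_A \<beta> (n - k)) * vilenkin_fourier m f k * vilenkin_psi m k x)
       / of_real (cesaro_A \<beta> n)"

text \<open>For \<open>p = \<infinity>\<close> the space is by convention the space of continuous functions with the
  supremum norm.\<close>

definition vilenkin_Lp :: "(nat \<Rightarrow> nat) \<Rightarrow> ennreal \<Rightarrow> ((nat \<Rightarrow> nat) \<Rightarrow> complex) set" where
  "vilenkin_Lp m p =
     (if p = \<infinity> then {f. continuous_map (vilenkin_topology m) euclidean f}
      else {f \<in> borel_measurable (vilenkin_measure m).
              integrable (vilenkin_measure m) (\<lambda>x. norm (f x) powr enn2real p)})"

definition vilenkin_norm :: "(nat \<Rightarrow> nat) \<Rightarrow> ennreal \<Rightarrow> ((nat \<Rightarrow> nat) \<Rightarrow> complex) \<Rightarrow> real" where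
  "vilenkin_norm m p f =
     (if p = \<infinity> then (SUP x\<in>vilenkin_group m. norm (f x))
      else (LINT x|vilenkin_measure m. norm (f x) powr enn2real p) powr (1 / enn2real p))"

text \<open>\<open>vilenkin_modulus m p n f\<close> is $\omega(1/M_n, f)_p$.\<close>

definition vilenkin_modulus ::
  "(nat \<Rightarrow> nat) \<Rightarrow> ennreal \<Rightarrow> nat \<Rightarrow> ((nat \<Rightarrow> nat) \<Rightarrow> complex) \<Rightarrow> real" where
  "vilenkin_modulus m p n f =
     (SUP h\<in>vilenkin_I m n. vilenkin_norm m p (\<lambda>x. f (vilenkin_add m x h) - f x))"

end

theory Submission
  imports Defs
begin

text \<open>
  Write \<open>A n\<close> for \<open>cesaro_A (-\<alpha>) n\<close>. The mean \<open>\<sigma> f\<close> multiplies the \<open>v\<close>-th Fourier coefficient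
  of \<open>f\<close> by \<open>a v = A (n - v) / A n\<close>, so everything rests on \<open>L\<^sup>1\<close> bounds for kernels
  \<open>\<Sum>v<M K. h v * \<psi> v\<close>: by Minkowski's integral inequality (\<open>lp_bound_integral\<close>) such a bound
  controls the multiplier on every \<open>L\<^sup>p\<close> at once.

  The kernel bounds come from a martingale decomposition on the frequency side. Approximate
  \<open>h\<close> by sequences that are constant on the blocks \<open>[a * M i, (a + 1) * M i)\<close> and telescope over
  \<open>i\<close>. A multiplier that is constant on these blocks has a kernel divisible by the
  Dirichlet kernel \<open>\<Sum>v<M i. \<psi> v\<close>, which lives on a subgroup of measure \<open>1 / M i\<close>; hence
  Cauchy--Schwarz and Parseval bound its \<open>L\<^sup>1\<close> norm by the \<open>l\<^sup>2\<close> norm of its block values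
  (\<open>block_kernel_L1\<close>, \<open>multiplier_L1_telescope\<close>), without any logarithmic loss. There are two
  applications.

  \<^item> For \<open>h v = A (n - v)\<close> when \<open>v \<le> n\<close> and \<open>0\<close> otherwise, the block values at
    level \<open>i\<close> may be chosen monotone up to \<open>n\<close> and at most \<open>(M i) powr (-\<alpha>)\<close>. The \<open>l\<^sup>2\<close> norms
    are then summable over \<open>i\<close> and the kernel has bounded \<open>L\<^sup>1\<close> norm (\<open>cesaro_kernel_L1\<close>).
    Division by \<open>A n\<close> costs the factor \<open>n powr \<alpha>\<close>.

  \<^item> For \<open>v < M (k - 1)\<close>, hence \<open>v \<le> n / 2\<close>, the sequence \<open>a v - 1\<close> vanishes at \<open>0\<close> and is Lipschitz
    with constant of order \<open>1 / M k\<close>. Restricted to \<open>v < M j\<close> it has a kernel of \<open>L\<^sup>1\<close> norm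
    of order \<open>M j / M k\<close> (\<open>lipschitz_multiplier_L1\<close>).

  Let \<open>R r f\<close> be \<open>f\<close> minus its partial sum of order \<open>M r\<close>. This is an average of the differences
  \<open>f - f(\<cdot> \<oplus> t)\<close> over \<open>t\<close> in the subgroup \<open>I\<^sub>r\<close>, so its norm is at most \<open>\<omega>(1/M\<^sub>r, f)\<close>. Splitting the
  frequencies at \<open>M (k - 1)\<close> and the lower ones into the shells \<open>[M r, M (r + 1))\<close> gives
  (\<open>cesaro_mean_minus_eq\<close>)
  \<open>\<sigma> f - f = \<sigma> (R (k-1) f) - R (k-1) f + (\<Sum>r<k-1. Q r (R r f))\<close>,
  where \<open>Q r\<close> is the multiplier \<open>a v - 1\<close> restricted to \<open>v < M (r + 1)\<close>. The first kernel bound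
  applied to the first term and the second to each \<open>Q r\<close> give the theorem.
\<close>

section \<open>Binomial coefficients of negative order\<close>

lemma cesaro_A_0 [simp]: "cesaro_A \<beta> 0 = 1"
  by (simp add: cesaro_A_def)

lemma cesaro_A_Suc: "cesaro_A \<beta> (Suc n) = cesaro_A \<beta> n * (1 + \<beta> / real (Suc n))"
  by (simp add: cesaro_A_def field_simps)

context
  fixes \<alpha> :: real
  assumes \<alpha>: "0 < \<alpha>" "\<alpha> < 1"
begin

lemma cesaro_A_pos: "0 < cesaro_A (-\<alpha>) n"
proof (induction n)
  case (Suc n)
  have "\<alpha> / real (Suc n) < 1"
    using \<alpha> by (simp add: divide_less_eq)
  with Suc show ?case
    by (simp add: cesaro_A_Suc)
qed simp

lemma cesaro_A_antimono:
  assumes "i \<le> j"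
  shows "cesaro_A (-\<alpha>) j \<le> cesaro_A (-\<alpha>) i"
proof -
  have "cesaro_A (-\<alpha>) (Suc n) \<le> cesaro_A (-\<alpha>) n" for n
    using cesaro_A_pos[of n] \<alpha> by (simp add: cesaro_A_Suc mult_le_cancel_left1)
  with assms show ?thesis
    by (rule lift_Suc_antimono_le[rotated])
qed

lemma powr_le_affine:
  assumes "0 < (a::real)"
  shows "a powr \<alpha> \<le> 1 + \<alpha> * (a - 1)"
  using Youngs_inequality_0[of \<alpha> "1 - \<alpha>" a 1] \<alpha> assms by (simp add: algebra_simps)

text \<open>The coefficients decrease by the factors \<open>1 - \<alpha> / j\<close>. Here and in \<open>cesaro_A_mult_powr_mono\<close> these
  are compared with the factors for a power, through Bernoulli's inequality.\<close>

lemma cesaro_A_le_powr: "cesaro_A (-\<alpha>) n \<le> real (Suc n) powr (-\<alpha>)"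
proof (induction n)
  case (Suc n)
  define t where "t = real (Suc n)"
  have t: "t \<ge> 1" by (simp add: t_def)
  have "(1 - \<alpha> / t) * ((t + 1) / t) powr \<alpha> \<le> (1 - \<alpha> / t) * (1 + \<alpha> / t)"
    using powr_le_affine[of "(t + 1) / t"] t \<alpha>
    by (intro mult_left_mono) (auto simp: field_simps)
  also have "\<dots> \<le> 1"
    by (simp add: algebra_simps)
  finally have "(1 - \<alpha> / t) * (t + 1) powr \<alpha> \<le> t powr \<alpha>"
    using t by (simp add: powr_divide field_simps)
  then have step: "t powr (-\<alpha>) * (1 - \<alpha> / t) \<le> (t + 1) powr (-\<alpha>)"
    using t by (simp add: powr_minus field_simps)
  have "cesaro_A (-\<alpha>) (Suc n) = cesaro_A (-\<alpha>) n * (1 - \<alpha> / t)"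
    by (simp add: cesaro_A_Suc t_def)
  also have "\<dots> \<le> t powr (-\<alpha>) * (1 - \<alpha> / t)"
    using Suc t \<alpha> by (intro mult_right_mono) (auto simp: t_def)
  finally show ?case
    using step by (simp add: t_def add.commute)
qed simp

lemma cesaro_A_mult_powr_mono:
  assumes "1 \<le> i" "i \<le> j"
  shows "cesaro_A (-\<alpha>) i * real i powr \<alpha> \<le> cesaro_A (-\<alpha>) j * real j powr \<alpha>"
  using assms(2)
proof (induction j rule: dec_induct)
  case (step j)
  define t where "t = real (Suc j)"
  have t: "t > 1" "real j = t - 1" using step assms by (auto simp: t_def)
  have "((t - 1) / t) powr \<alpha> \<le> 1 - \<alpha> / t"
    using powr_le_affine[of "(t - 1) / t"] t by (simp add: field_simps)
  then have "(t - 1) powr \<alpha> \<le> (1 - \<alpha> / t) * t powr \<alpha>"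
    using t by (simp add: powr_divide field_simps)
  then have "cesaro_A (-\<alpha>) j * real j powr \<alpha> \<le> cesaro_A (-\<alpha>) j * ((1 - \<alpha> / t) * t powr \<alpha>)"
    using cesaro_A_pos[of j] t by (intro mult_left_mono) auto
  also have "\<dots> = cesaro_A (-\<alpha>) (Suc j) * real (Suc j) powr \<alpha>"
    by (simp add: cesaro_A_Suc t_def)
  finally show ?case using step by simp
qed simp

lemma inverse_cesaro_A_le:
  assumes "1 \<le> n"
  shows "1 / cesaro_A (-\<alpha>) n \<le> real n powr \<alpha> / (1 - \<alpha>)"
proof -
  have "1 - \<alpha> \<le> cesaro_A (-\<alpha>) n * real n powr \<alpha>"
    using cesaro_A_mult_powr_mono[of 1 n] assms by (simp add: cesaro_A_Suc)
  then show ?thesis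
    using \<alpha> cesaro_A_pos[of n] by (simp add: field_simps)
qed

lemma cesaro_A_doubling:
  assumes "1 \<le> i" "i \<le> n" "n \<le> 2 * i"
  shows "cesaro_A (-\<alpha>) i \<le> 2 * cesaro_A (-\<alpha>) n"
proof -
  have "real n powr \<alpha> \<le> (2 * real i) powr \<alpha>"
    using assms \<alpha> by (intro powr_mono2) auto
  also have "\<dots> \<le> 2 * real i powr \<alpha>"
    using powr_mono[of \<alpha> 1 2] \<alpha> by (simp add: powr_mult mult_right_mono)
  finally have "cesaro_A (-\<alpha>) i * real i powr \<alpha> \<le> cesaro_A (-\<alpha>) n * (2 * real i powr \<alpha>)"
    using cesaro_A_mult_powr_mono[OF assms(1,2)] cesaro_A_pos[of n]
    by (meson mult_left_mono order_trans less_imp_le)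
  then show ?thesis
    using assms by simp
qed

text \<open>For indices at most \<open>n / 2\<close> the consecutive differences are \<open>\<alpha> / j\<close> times a coefficient that is
  comparable to \<open>cesaro_A (-\<alpha>) n\<close> by doubling.\<close>

lemma cesaro_A_ratio_lipschitz:
  assumes "v \<le> w" "2 * w \<le> n" "1 \<le> n"
  shows "cesaro_A (-\<alpha>) (n - w) / cesaro_A (-\<alpha>) n - cesaro_A (-\<alpha>) (n - v) / cesaro_A (-\<alpha>) n
           \<le> 4 * real (w - v) / real n"
  using assms
proof (induction w rule: dec_induct)
  case (step w)
  define j where "j = n - Suc w"
  have j: "n - w = Suc j" "1 \<le> j" "j \<le> n" "n \<le> 2 * j"
    using step by (auto simp: j_def)
  have "cesaro_A (-\<alpha>) j - cesaro_A (-\<alpha>) (Suc j) = cesaro_A (-\<alpha>) j * (\<alpha> / real (Suc j))"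
    by (simp add: cesaro_A_Suc algebra_simps)
  also have "\<dots> \<le> (2 * cesaro_A (-\<alpha>) n) * (2 / real n)"
  proof (intro mult_mono)
    show "\<alpha> / real (Suc j) \<le> 2 / real n"
    proof -
      have "\<alpha> * real n \<le> 1 * real n" using \<alpha> by (intro mult_right_mono) auto
      also have "\<dots> \<le> 2 * real (Suc j)" using j by simp
      finally show ?thesis using j by (simp add: field_simps)
    qed
  qed (use j cesaro_A_doubling[of j n] cesaro_A_pos[of n] cesaro_A_pos[of j] \<alpha> in auto)
  finally have "cesaro_A (-\<alpha>) j / cesaro_A (-\<alpha>) n - cesaro_A (-\<alpha>) (Suc j) / cesaro_A (-\<alpha>) n
      \<le> 4 / real n"
    using cesaro_A_pos[of n] step(5) by (simp add: field_simps)
  moreover have "cesaro_A (-\<alpha>) (n - w) / cesaro_A (-\<alpha>) n - cesaro_A (-\<alpha>) (n - v) / cesaro_A (-\<alpha>) n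
           \<le> 4 * real (w - v) / real n"
    using step by simp
  moreover have "4 * real (Suc w - v) / real n = 4 * real (w - v) / real n + 4 / real n"
    using step by (simp add: Suc_diff_le add_divide_distrib)
  ultimately show ?case
    by (simp add: j_def [symmetric] j(1))
qed simp

end

section \<open>Elementary sums and inequalities\<close>

text \<open>A sum telescoping with step \<open>c\<close>: only the last \<open>c\<close> terms survive. When \<open>N < c\<close>, truncated
  subtraction makes the right-hand side the full sum, as it should be.\<close>

lemma sum_shift_difference:
  fixes X :: "nat \<Rightarrow> real"
  shows "(\<Sum>a<N. X a - (if a < c then 0 else X (a - c))) = (\<Sum>a=N-c..<N. X a)"
proof (induction N)
  case (Suc N)
  show ?case
  proof (cases "N < c")
    case True
    then show ?thesis using Suc by (simp add: lessThan_atLeast0)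
  next
    case False
    then have "(\<Sum>a=N-c..<Suc N. X a) = X (N - c) + (\<Sum>a=Suc N-c..<Suc N. X a)"
      by (subst sum.atLeast_Suc_lessThan) (auto simp: Suc_diff_le)
    moreover have "(\<Sum>a=N-c..<Suc N. X a) = (\<Sum>a=N-c..<N. X a) + X N"
      by simp
    ultimately show ?thesis using Suc False by simp
  qed
qed simp

lemma sum_lessThan_blocks:
  fixes g :: "nat \<Rightarrow> 'a::comm_monoid_add"
  shows "(\<Sum>v<L * N. g v) = (\<Sum>a<L. \<Sum>u<N. g (a * N + u))"
proof -
  have "(\<Sum>u<N. g (a * N + u)) = sum g {a * N..<a * N + N}" for a
    using sum.shift_bounds_nat_ivl[of g 0 "a * N" N] by (simp add: lessThan_atLeast0 add.commute)
  then show ?thesis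
    by (simp add: sum.nat_group)
qed

lemma sum_geometric_le:
  fixes s :: real
  assumes "0 \<le> s" "s < 1"
  shows "(\<Sum>i<n. s ^ i) \<le> 1 / (1 - s)"
  using assms by (simp add: sum_gp_strict divide_right_mono)

text \<open>Convexity of \<open>y powr p\<close> in the form of its tangent at \<open>b\<close>, solved for \<open>y\<close>. Being linear in
  \<open>y powr p\<close>, it can be integrated with \<open>b\<close> fixed and \<open>b\<close> chosen afterwards; this is how both
  Minkowski inequalities below are obtained.\<close>

lemma powr_tangent:
  fixes p b y :: real
  assumes "1 \<le> p" "0 < b" "0 \<le> y"
  shows "y \<le> (1 - 1 / p) * b + 1 / p * (b powr (1 - p) * y powr p)"
proof (cases "y = 0")
  case False
  then have "y > 0" using assms by simp
  have "(b powr (1 - p) * y powr p) powr (1 / p) * b powr (1 - 1 / p)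
      = y * (b powr ((1 - p) * (1 / p)) * b powr (1 - 1 / p))"
    using assms \<open>y > 0\<close> by (simp add: powr_mult powr_powr)
  also have "\<dots> = y"
    using assms by (simp add: powr_add[symmetric] field_simps)
  finally show ?thesis
    using Youngs_inequality_0[of "1 / p" "1 - 1 / p" "b powr (1 - p) * y powr p" b] assms \<open>y > 0\<close>
    by simp
qed (use assms in auto)

section \<open>The Vilenkin group\<close>

locale vilenkin =
  fixes m :: "nat \<Rightarrow> nat"
  assumes m_ge_2: "2 \<le> m k"
begin

abbreviation "\<mu> \<equiv> vilenkin_measure m"
abbreviation "G \<equiv> vilenkin_group m"
abbreviation "M \<equiv> vilenkin_M m"
abbreviation "\<psi> \<equiv> vilenkin_psi m"
abbreviation add (infixl "\<oplus>" 65) where "x \<oplus> y \<equiv> vilenkin_add m x y"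

lemma m_pos [simp]: "0 < m k"
  using m_ge_2[of k] by simp

lemma M_pos [simp]: "0 < M k"
  by (simp add: vilenkin_M_def prod_pos)

lemma M_neq_0 [simp]: "M k \<noteq> 0"
  using M_pos[of k] by simp

lemma Suc_0_le_m [simp]: "Suc 0 \<le> m k"
  using m_ge_2[of k] by linarith

lemma M_add: "M (i + j) = M i * (\<Prod>l=i..<i+j. m l)"
  using prod.atLeastLessThan_concat[of 0 i "i + j" m] by (simp add: vilenkin_M_def lessThan_atLeast0)

lemma M_dvd: "i \<le> j \<Longrightarrow> M i dvd M j"
  using M_add[of i "j - i"] by simp

lemma M_mono: "i \<le> j \<Longrightarrow> M i \<le> M j"
  by (simp add: M_dvd dvd_imp_le)

lemma M_growth: "M i * 2 ^ j \<le> M (i + j)"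
proof -
  have "2 ^ j = (\<Prod>l=i..<i+j. 2::nat)" by simp
  also have "\<dots> \<le> (\<Prod>l=i..<i+j. m l)" by (intro prod_mono) (auto simp: m_ge_2)
  finally show ?thesis by (simp add: M_add)
qed

lemma less_M: "k < M k"
proof -
  have "k < 2 ^ k" by (rule less_exp)
  also have "2 ^ k \<le> M k" using M_growth[of 0 k] by (simp add: vilenkin_M_rec)
  finally show ?thesis .
qed

section \<open>The group and its Haar measure\<close>

lemma group_iff: "x \<in> G \<longleftrightarrow> (\<forall>k. x k < m k)"
  by (auto simp: vilenkin_group_def PiE_iff)

lemma add_in_group [simp]: "x \<oplus> y \<in> G"
  by (simp add: group_iff vilenkin_add_def)

lemma add_commute: "x \<oplus> y = y \<oplus> x"
  by (simp add: vilenkin_add_def add.commute)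

sublocale coord: product_prob_space "\<lambda>k. uniform_count_measure {..<m k}" "UNIV :: nat set"
  by (intro product_prob_spaceI prob_space_uniform_count_measure) (auto simp: lessThan_empty_iff bot_nat_def)

sublocale haar: prob_space \<mu>
  unfolding vilenkin_measure_def by (rule coord.P.prob_space_axioms)

lemma measurable_coordinate [measurable]: "(\<lambda>x. x k) \<in> \<mu> \<rightarrow>\<^sub>M count_space UNIV"
proof -
  have "(\<lambda>x. x k) \<in> \<mu> \<rightarrow>\<^sub>M uniform_count_measure {..<m k}"
    unfolding vilenkin_measure_def by (rule measurable_component_singleton) simp
  then have "(\<lambda>x. x k) \<in> \<mu> \<rightarrow>\<^sub>M count_space {..<m k}"
    by (simp only: measurable_cong_sets[OF refl sets_uniform_count_measure_count_space])
  from measurable_compose[OF this, of "\<lambda>x. x" "count_space UNIV"] show ?thesis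
    by simp
qed

text \<open>Every coordinate takes values in a finite discrete set, so measurability into the group reduces
  to measurability of coordinates as functions into the discrete space of naturals.\<close>

lemma measurable_vilenkinI:
  assumes "\<And>k. (\<lambda>x. F x k) \<in> N \<rightarrow>\<^sub>M count_space UNIV"
    and "\<And>x. x \<in> space N \<Longrightarrow> F x \<in> G"
  shows "F \<in> N \<rightarrow>\<^sub>M \<mu>"
  unfolding vilenkin_measure_def
proof (rule measurable_PiM_single')
  fix k
  have "(\<lambda>x. F x k) \<in> N \<rightarrow>\<^sub>M count_space {..<m k}"
  proof (rule measurableI)
    fix x assume "x \<in> space N"
    then show "F x k \<in> space (count_space {..<m k})"
      using assms(2) by (simp add: group_iff)
  next
    fix A assume "A \<in> sets (count_space {..<m k})"
    show "(\<lambda>x. F x k) -` A \<inter> space N \<in> sets N"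
      using assms(1) by (rule measurable_sets) simp
  qed
  then show "(\<lambda>x. F x k) \<in> N \<rightarrow>\<^sub>M uniform_count_measure {..<m k}"
    by (simp only: measurable_cong_sets[OF refl sets_uniform_count_measure_count_space])
next
  show "F \<in> space N \<rightarrow> (\<Pi>\<^sub>E k\<in>UNIV. space (uniform_count_measure {..<m k}))"
    using assms(2) by (auto simp: vilenkin_group_def space_uniform_count_measure)
qed

lemma measurable_add_pair [measurable]: "(\<lambda>z. fst z \<oplus> snd z) \<in> \<mu> \<Otimes>\<^sub>M \<mu> \<rightarrow>\<^sub>M \<mu>"
proof (rule measurable_vilenkinI)
  fix k
  have [measurable]: "(\<lambda>z. fst z k) \<in> \<mu> \<Otimes>\<^sub>M \<mu> \<rightarrow>\<^sub>M count_space UNIV"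
    "(\<lambda>z. snd z k) \<in> \<mu> \<Otimes>\<^sub>M \<mu> \<rightarrow>\<^sub>M count_space UNIV"
    by (auto intro: measurable_compose[OF measurable_fst measurable_coordinate]
        measurable_compose[OF measurable_snd measurable_coordinate])
  show "(\<lambda>z. (fst z \<oplus> snd z) k) \<in> \<mu> \<Otimes>\<^sub>M \<mu> \<rightarrow>\<^sub>M count_space UNIV"
    unfolding vilenkin_add_def
  proof (rule measurable_compose_countable[where g = "\<lambda>z. fst z k"])
    show "(\<lambda>z. (i + snd z k) mod m k) \<in> \<mu> \<Otimes>\<^sub>M \<mu> \<rightarrow>\<^sub>M count_space UNIV" for i
      by (rule measurable_compose[where g = "\<lambda>c. (i + c) mod m k", OF \<open>(\<lambda>z. snd z k) \<in> _\<close>]) simp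
  qed fact
qed simp

lemma measurable_translate:
  assumes "h \<in> G"
  shows "(\<lambda>x. x \<oplus> h) \<in> \<mu> \<rightarrow>\<^sub>M \<mu>" "(\<lambda>x. h \<oplus> x) \<in> \<mu> \<rightarrow>\<^sub>M \<mu>"
proof -
  show "(\<lambda>x. x \<oplus> h) \<in> \<mu> \<rightarrow>\<^sub>M \<mu>"
  proof (rule measurable_vilenkinI)
    show "(\<lambda>x. (x \<oplus> h) k) \<in> \<mu> \<rightarrow>\<^sub>M count_space UNIV" for k
      unfolding vilenkin_add_def
      by (rule measurable_compose[where g = "\<lambda>c. (c + h k) mod m k", OF measurable_coordinate]) simp
  qed simp
  then show "(\<lambda>x. h \<oplus> x) \<in> \<mu> \<rightarrow>\<^sub>M \<mu>"
    by (simp add: add_commute)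
qed

text \<open>Translation permutes the residues in each coordinate, so it preserves the measure of every
  finite-dimensional box.\<close>

lemma distr_translate:
  assumes h: "h \<in> G"
  shows "distr \<mu> \<mu> (\<lambda>x. x \<oplus> h) = \<mu>"
proof -
  let ?U = "\<lambda>k. uniform_count_measure {..<m k}"
  have "distr \<mu> \<mu> (\<lambda>x. x \<oplus> h) = PiM UNIV ?U"
  proof (rule coord.PiM_eq)
    show "sets (distr \<mu> \<mu> (\<lambda>x. x \<oplus> h)) = sets (PiM UNIV ?U)"
      by (simp add: vilenkin_measure_def)
    fix J F assume J: "finite J" "J \<subseteq> (UNIV :: nat set)"
      and F: "\<And>j. j \<in> J \<Longrightarrow> F j \<in> sets (?U j)"
    define H where "H j = {a \<in> {..<m j}. (a + h j) mod m j \<in> F j}" for j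
    have inj: "inj_on (\<lambda>a. (a + h j) mod m j) {..<m j}" for j
    proof (rule inj_onI)
      fix a b assume "a \<in> {..<m j}" "b \<in> {..<m j}" "(a + h j) mod m j = (b + h j) mod m j"
      then have "(int a + int (h j)) mod int (m j) = (int b + int (h j)) mod int (m j)"
        by (simp add: zmod_int[symmetric] of_nat_add[symmetric] del: of_nat_add)
      then have "int (m j) dvd int a - int b"
        by (simp add: mod_eq_dvd_iff)
      moreover have "\<bar>int a - int b\<bar> < int (m j)"
        using \<open>a \<in> _\<close> \<open>b \<in> _\<close> by auto
      ultimately show "a = b"
        using dvd_imp_le_int[of "int a - int b" "int (m j)"] by auto
    qed
    then have onto: "(\<lambda>a. (a + h j) mod m j) ` {..<m j} = {..<m j}" for j
      by (intro endo_inj_surj) auto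
    have card: "card (H j) = card (F j)" if "j \<in> J" for j
    proof -
      have "(\<lambda>a. (a + h j) mod m j) ` H j = F j"
      proof
        show "F j \<subseteq> (\<lambda>a. (a + h j) mod m j) ` H j"
        proof
          fix b assume b: "b \<in> F j"
          with F[OF that] have "b \<in> {..<m j}" by (auto simp: sets_uniform_count_measure)
          then obtain a where "a \<in> {..<m j}" "b = (a + h j) mod m j"
            using onto[of j] by auto
          with b show "b \<in> (\<lambda>a. (a + h j) mod m j) ` H j"
            by (auto simp: H_def)
        qed
      qed (auto simp: H_def)
      then show ?thesis
        using card_image[OF inj_on_subset[OF inj[of j], of "H j"]] by (simp add: H_def subset_iff)
    qed
    have "emeasure (distr \<mu> \<mu> (\<lambda>x. x \<oplus> h)) (prod_emb UNIV ?U J (\<Pi>\<^sub>E j\<in>J. F j))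
        = emeasure \<mu> ((\<lambda>x. x \<oplus> h) -` prod_emb UNIV ?U J (\<Pi>\<^sub>E j\<in>J. F j) \<inter> space \<mu>)"
      using J F by (intro emeasure_distr measurable_translate h)
        (auto simp: vilenkin_measure_def intro!: sets_PiM_I)
    also have "(\<lambda>x. x \<oplus> h) -` prod_emb UNIV ?U J (\<Pi>\<^sub>E j\<in>J. F j) \<inter> space \<mu>
        = prod_emb UNIV ?U J (\<Pi>\<^sub>E j\<in>J. H j)"
      by (auto simp: prod_emb_def space_vilenkin_measure group_iff H_def vilenkin_add_def
          space_uniform_count_measure PiE_iff)
    also have "emeasure \<mu> \<dots> = (\<Prod>j\<in>J. emeasure (?U j) (H j))"
      unfolding vilenkin_measure_def
      by (rule coord.emeasure_PiM_emb) (use J in \<open>auto simp: sets_uniform_count_measure H_def\<close>)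
    also have "\<dots> = (\<Prod>j\<in>J. emeasure (?U j) (F j))"
    proof (rule prod.cong)
      fix j assume "j \<in> J"
      with F[OF this] card show "emeasure (?U j) (H j) = emeasure (?U j) (F j)"
        by (subst (1 2) emeasure_uniform_count_measure)
          (auto simp: sets_uniform_count_measure H_def)
    qed simp
    finally show "emeasure (distr \<mu> \<mu> (\<lambda>x. x \<oplus> h)) (prod_emb UNIV ?U J (\<Pi>\<^sub>E j\<in>J. F j))
        = (\<Prod>j\<in>J. emeasure (?U j) (F j))" .
  qed
  then show ?thesis by (simp add: vilenkin_measure_def)
qed

lemma integral_translate:
  fixes f :: "(nat \<Rightarrow> nat) \<Rightarrow> 'b::{banach, second_countable_topology}"
  assumes "h \<in> G" "f \<in> borel_measurable \<mu>"
  shows "(\<integral>x. f (x \<oplus> h) \<partial>\<mu>) = (\<integral>x. f x \<partial>\<mu>)"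
  using integral_distr[OF measurable_translate(1)[OF assms(1)] assms(2)]
  by (simp add: distr_translate assms)

lemma nn_integral_translate:
  assumes "h \<in> G" "f \<in> borel_measurable \<mu>"
  shows "(\<integral>\<^sup>+x. f (x \<oplus> h) \<partial>\<mu>) = (\<integral>\<^sup>+x. f x \<partial>\<mu>)"
  using nn_integral_distr[OF measurable_translate(1)[OF assms(1)], of f] assms
  by (simp add: distr_translate)

section \<open>Characters\<close>

lemma digit_less: "vilenkin_digit m n k < m k"
  by (simp add: vilenkin_digit_def)

lemma digit_high: "n < M k \<Longrightarrow> k \<le> j \<Longrightarrow> vilenkin_digit m n j = 0"
  using M_mono[of k j] by (simp add: vilenkin_digit_def)

text \<open>Adding \<open>u < M i\<close> to a multiple of \<open>M i\<close> produces no carry: the digits below \<open>i\<close> come from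
  \<open>u\<close> and the remaining ones from the multiple.\<close>

lemma digit_split:
  assumes "u < M i"
  shows "vilenkin_digit m (a * M i + u) k = vilenkin_digit m (a * M i) k + vilenkin_digit m u k"
proof (cases "k < i")
  case True
  then obtain b where b: "M i = M k * m k * b"
    using M_dvd[of "Suc k" i] by (auto simp: vilenkin_M_rec dvd_def mult_ac)
  have "(a * M i + u) div M k = a * m k * b + u div M k"
    using div_mult_self1[of "M k" u "a * m k * b"] by (simp add: b mult_ac add.commute)
  moreover have "a * M i div M k = a * m k * b"
    by (simp add: b mult_ac)
  ultimately show ?thesis
    using mod_mult_self1[of "u div M k" "a * b" "m k"]
    by (simp add: vilenkin_digit_def mult_ac add.commute)
next
  case False
  then obtain b where b: "M k = M i * b"
    using M_dvd[of i k] by (auto simp: dvd_def)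
  have "(a * M i + u) div M k = a * M i div M k"
    using assms by (simp add: b div_mult2_eq)
  then show ?thesis
    using digit_high[OF assms, of k] False by (simp add: vilenkin_digit_def)
qed

lemma digit_single:
  assumes "d < m i"
  shows "vilenkin_digit m (d * M i) k = (if k = i then d else 0)"
proof (cases k i rule: linorder_cases)
  case less
  then obtain b where b: "M i = M k * m k * b"
    using M_dvd[of "Suc k" i] by (auto simp: vilenkin_M_rec dvd_def mult_ac)
  have "d * M i div M k = d * m k * b"
    by (simp add: b mult_ac)
  then show ?thesis
    using less by (simp add: vilenkin_digit_def mult_ac)
next
  case greater
  have "d * M i < M (Suc i)"
    using assms by (simp add: vilenkin_M_rec)
  then show ?thesis
    using greater digit_high[of "d * M i" "Suc i" k] by simp
qed (use assms in \<open>simp add: vilenkin_digit_def\<close>)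

lemma psi_eq_prod:
  assumes "n < M N"
  shows "\<psi> n x = (\<Prod>k<N. vilenkin_r m k x ^ vilenkin_digit m n k)"
proof -
  have "{k. vilenkin_digit m n k \<noteq> 0} \<subseteq> {..<N}"
    using digit_high[OF assms] by (metis (mono_tags, lifting) lessThan_iff mem_Collect_eq not_less subsetI)
  then show ?thesis
    unfolding vilenkin_psi_def by (intro prod.mono_neutral_left) auto
qed

lemma r_add: "vilenkin_r m k (x \<oplus> y) = vilenkin_r m k x * vilenkin_r m k y"
proof -
  have "exp (2 * of_real pi * \<i> * of_nat ((a + b) mod m k) / of_nat (m k))
      = exp (2 * of_real pi * \<i> * of_nat (a + b) / of_nat (m k))" for a b
    by (subst complex_root_unity_eq) (auto simp: cong_def)
  then show ?thesis
    by (simp add: vilenkin_r_def vilenkin_add_def exp_add[symmetric] add_divide_distrib ring_distribs)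
qed

lemma norm_r [simp]: "norm (vilenkin_r m k x) = 1"
  by (simp add: vilenkin_r_def norm_exp_eq_Re)

lemma measurable_r [measurable]: "vilenkin_r m k \<in> borel_measurable \<mu>"
proof -
  have "(\<lambda>x. (\<lambda>c. exp (2 * of_real pi * \<i> * of_nat c / of_nat (m k)) :: complex) (x k)) \<in> borel_measurable \<mu>"
    by (rule measurable_compose[OF measurable_coordinate]) simp
  then show ?thesis by (simp add: vilenkin_r_def[abs_def])
qed

lemma psi_add: "\<psi> n (x \<oplus> y) = \<psi> n x * \<psi> n y"
  by (simp add: vilenkin_psi_def r_add power_mult_distrib prod.distrib)

lemma norm_psi [simp]: "norm (\<psi> n x) = 1"
  by (simp add: vilenkin_psi_def prod_norm[symmetric] norm_power)

lemma psi_cnj [simp]: "\<psi> n x * cnj (\<psi> n x) = 1"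
  by (simp add: complex_norm_square[symmetric])

lemma measurable_cnj_comp [measurable (raw)]:
  fixes q :: "'b \<Rightarrow> complex"
  assumes "q \<in> borel_measurable N"
  shows "(\<lambda>x. cnj (q x)) \<in> borel_measurable N"
  using assms by (rule measurable_compose) (intro borel_measurable_continuous_onI continuous_intros)

lemma psi_0 [simp]: "\<psi> 0 x = 1"
  by (simp add: vilenkin_psi_def vilenkin_digit_def)

lemma measurable_psi [measurable]: "\<psi> n \<in> borel_measurable \<mu>"
  unfolding vilenkin_psi_def[abs_def] by measurable

lemma psi_split:
  assumes "u < M i"
  shows "\<psi> (a * M i + u) x = \<psi> (a * M i) x * \<psi> u x"
proof -
  define N where "N = a * M i + u"
  have "a * M i < M N" "u < M N" "a * M i + u < M N"
    using less_M[of N] by (auto simp: N_def)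
  from this[THEN psi_eq_prod] show ?thesis
    by (simp add: digit_split[OF assms] power_add prod.distrib)
qed

lemma psi_single:
  assumes "d < m i"
  shows "\<psi> (d * M i) x = vilenkin_r m i x ^ d"
proof -
  have "d * M i < M (Suc i)"
    using assms by (simp add: vilenkin_M_rec)
  then have "\<psi> (d * M i) x = (\<Prod>k<Suc i. vilenkin_r m k x ^ (if k = i then d else 0))"
    by (simp only: psi_eq_prod digit_single[OF assms])
  also have "\<dots> = vilenkin_r m i x ^ d"
    by (simp add: if_distrib prod.delta cong: if_cong)
  finally show ?thesis .
qed

text \<open>At a point whose \<open>k\<close>-th coordinate is \<open>1\<close>, the Rademacher function is a primitive root of unity.\<close>

lemma r_power_inj:
  assumes "x k = 1" "d < m k" "e < m k" "vilenkin_r m k x ^ d = vilenkin_r m k x ^ e"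
  shows "d = e"
proof -
  have r: "vilenkin_r m k x ^ c = exp (2 * of_real pi * \<i> * of_nat c / of_nat (m k))" for c
    by (simp add: vilenkin_r_def assms exp_of_nat_mult[symmetric] mult_ac)
  show ?thesis
    using assms(2-) unfolding r by (subst (asm) complex_root_unity_eq) (auto simp: cong_def)
qed

text \<open>Translation by the unit vector \<open>h\<close> at a digit where \<open>n\<close> and \<open>n'\<close> differ multiplies the integrand
  by a constant different from \<open>1\<close>, while invariance leaves the integral unchanged.\<close>

lemma psi_orthogonal:
  assumes "n \<noteq> n'"
  shows "(\<integral>x. \<psi> n x * cnj (\<psi> n' x) \<partial>\<mu>) = 0"
proof -
  define N where "N = n + n'"
  have N: "n < M N" "n' < M N" using less_M[of N] by (auto simp: N_def)
  obtain k where k: "vilenkin_digit m n k \<noteq> vilenkin_digit m n' k"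
    using vilenkin_digit_expansion[OF N(1)] vilenkin_digit_expansion[OF N(2)] assms by force
  define h where "h j = (if j = k then 1 else 0::nat)" for j
  have h: "h \<in> G" using m_ge_2[of k] by (auto simp: group_iff h_def)
  have psi_h: "\<psi> l h = vilenkin_r m k h ^ vilenkin_digit m l k" for l
  proof -
    have "vilenkin_r m j h = 1" if "j \<noteq> k" for j
      using that by (simp add: vilenkin_r_def h_def)
    then have "\<psi> l h = (\<Prod>j<Suc (l + k). if j = k then vilenkin_r m k h ^ vilenkin_digit m l k else 1)"
      using less_M[of "Suc (l + k)"]
      by (subst psi_eq_prod[of l "Suc (l + k)"]) (linarith, intro prod.cong, auto)
    then show ?thesis by (simp add: prod.delta del: prod.lessThan_Suc)
  qed
  define c where "c = \<psi> n h * cnj (\<psi> n' h)"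
  have "c \<noteq> 1"
  proof
    assume "c = 1"
    then have "\<psi> n h * (cnj (\<psi> n' h) * \<psi> n' h) = \<psi> n' h"
      by (simp add: c_def mult.assoc[symmetric])
    then have "\<psi> n h = \<psi> n' h"
      by (simp add: mult.commute)
    with k show False
      using r_power_inj[of h k] digit_less by (auto simp: psi_h h_def)
  qed
  have "(\<integral>x. \<psi> n x * cnj (\<psi> n' x) \<partial>\<mu>) = (\<integral>x. \<psi> n (x \<oplus> h) * cnj (\<psi> n' (x \<oplus> h)) \<partial>\<mu>)"
    using integral_translate[OF h, of "\<lambda>x. \<psi> n x * cnj (\<psi> n' x)"] by simp
  also have "\<dots> = (\<integral>x. c * (\<psi> n x * cnj (\<psi> n' x)) \<partial>\<mu>)"
    by (simp add: psi_add c_def mult_ac)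
  also have "\<dots> = c * (\<integral>x. \<psi> n x * cnj (\<psi> n' x) \<partial>\<mu>)"
    by simp
  finally show ?thesis using \<open>c \<noteq> 1\<close> by simp
qed

lemma psi_orthonormal:
  "(\<integral>x. \<psi> n x * cnj (\<psi> n' x) \<partial>\<mu>) = (if n = n' then 1 else 0)"
  by (simp add: psi_orthogonal haar.prob_space)

lemma integrable_bounded_vilenkin:
  fixes q :: "(nat \<Rightarrow> nat) \<Rightarrow> 'b::{banach, second_countable_topology}"
  assumes "q \<in> borel_measurable \<mu>" "\<And>x. norm (q x) \<le> B"
  shows "integrable \<mu> q"
  using assms by (intro haar.integrable_const_bound[of _ B]) auto

lemma integrable_psi_cnj [simp]: "integrable \<mu> (\<lambda>x. \<psi> n x * cnj (\<psi> n' x))"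
  by (rule integrable_bounded_vilenkin[of _ 1]) (measurable, simp add: norm_mult)

lemma integrable_psi [simp]: "integrable \<mu> (\<psi> n)"
  by (rule integrable_bounded_vilenkin[of _ 1]) auto

section \<open>Dirichlet kernels\<close>

definition dirichlet :: "nat \<Rightarrow> (nat \<Rightarrow> nat) \<Rightarrow> complex" where
  "dirichlet i x = (\<Sum>v<M i. \<psi> v x)"

lemma measurable_dirichlet [measurable]: "dirichlet i \<in> borel_measurable \<mu>"
  unfolding dirichlet_def[abs_def] by measurable

lemma r_eq_1_iff:
  assumes "x \<in> G"
  shows "vilenkin_r m k x = 1 \<longleftrightarrow> x k = 0"
proof -
  have "x k < m k" using assms by (simp add: group_iff)
  have "vilenkin_r m k x = exp (2 * of_real pi * \<i> * of_nat 0 / of_nat (m k)) \<longleftrightarrow> x k = 0"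
    unfolding vilenkin_r_def by (subst complex_root_unity_eq) (use \<open>x k < m k\<close> in \<open>auto simp: cong_def\<close>)
  then show ?thesis by simp
qed

lemma r_power_m: "vilenkin_r m k x ^ m k = 1"
  using complex_root_unity[of "m k" "x k"] by (simp add: vilenkin_r_def)

text \<open>Passing from \<open>i\<close> to \<open>i + 1\<close> multiplies the kernel by the geometric sum of the powers of
  an \<open>m i\<close>-th root of unity, which detects whether the \<open>i\<close>-th coordinate vanishes.\<close>

lemma dirichlet_eq:
  assumes x: "x \<in> G"
  shows "dirichlet i x = (if \<forall>j<i. x j = 0 then of_nat (M i) else 0)"
proof (induction i)
  case 0
  then show ?case by (simp add: dirichlet_def vilenkin_M_rec)
next
  case (Suc i)
  have "dirichlet (Suc i) x = (\<Sum>d<m i. \<Sum>u<M i. \<psi> (d * M i + u) x)"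
    by (simp add: dirichlet_def vilenkin_M_rec sum_lessThan_blocks)
  also have "\<dots> = (\<Sum>d<m i. vilenkin_r m i x ^ d) * dirichlet i x"
    by (simp add: psi_split psi_single dirichlet_def sum_product)
  also have "(\<Sum>d<m i. vilenkin_r m i x ^ d) = (if x i = 0 then of_nat (m i) else 0)"
  proof (cases "x i = 0")
    case True
    then show ?thesis using r_eq_1_iff[OF x, of i] by simp
  next
    case False
    then show ?thesis using r_eq_1_iff[OF x, of i] r_power_m[of i x]
      by (simp add: geometric_sum)
  qed
  finally show ?case
    by (auto simp: Suc less_Suc_eq vilenkin_M_rec)
qed

lemma integral_psi: "(\<integral>x. \<psi> n x \<partial>\<mu>) = (if n = 0 then 1 else 0)"
  using psi_orthonormal[of n 0] by simp

lemma integral_dirichlet: "(\<integral>x. dirichlet i x \<partial>\<mu>) = 1"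
  by (simp add: dirichlet_def integral_psi)

lemma dirichlet_real_nonneg:
  assumes "x \<in> G"
  shows "dirichlet i x = of_real (norm (dirichlet i x))"
  by (simp add: dirichlet_eq assms)

lemma integral_norm_dirichlet: "(\<integral>x. norm (dirichlet i x) \<partial>\<mu>) = 1"
proof -
  have "complex_of_real (\<integral>x. norm (dirichlet i x) \<partial>\<mu>) = (\<integral>x. of_real (norm (dirichlet i x)) \<partial>\<mu>)"
    by simp
  also have "\<dots> = (\<integral>x. dirichlet i x \<partial>\<mu>)"
    by (intro Bochner_Integration.integral_cong) (auto simp: space_vilenkin_measure dirichlet_real_nonneg[symmetric])
  finally show ?thesis by (simp add: integral_dirichlet)
qed

section \<open>L1 norms of multiplier kernels\<close>

lemma integrable_trig_poly [simp]: "integrable \<mu> (\<lambda>x. \<Sum>v<N. c v * \<psi> v x)"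
  by (intro Bochner_Integration.integrable_sum integrable_mult_right integrable_psi)

lemma measurable_trig_poly [measurable]: "(\<lambda>x. \<Sum>v<N. c v * \<psi> v x) \<in> borel_measurable \<mu>"
  using integrable_trig_poly by (rule borel_measurable_integrable)

lemma parseval:
  fixes c :: "nat \<Rightarrow> real"
  shows "(\<integral>x. (norm (\<Sum>v<N. of_real (c v) * \<psi> v x))\<^sup>2 \<partial>\<mu>) = (\<Sum>v<N. (c v)\<^sup>2)"
proof -
  have sq: "complex_of_real ((norm (\<Sum>v<N. of_real (c v) * \<psi> v x))\<^sup>2)
      = (\<Sum>v<N. \<Sum>w<N. of_real (c v * c w) * (\<psi> v x * cnj (\<psi> w x)))" for x
    unfolding complex_norm_square by (simp add: sum_product mult_ac)
  have "complex_of_real (\<integral>x. (norm (\<Sum>v<N. of_real (c v) * \<psi> v x))\<^sup>2 \<partial>\<mu>)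
      = (\<integral>x. complex_of_real ((norm (\<Sum>v<N. of_real (c v) * \<psi> v x))\<^sup>2) \<partial>\<mu>)"
    by (rule integral_complex_of_real[symmetric])
  also have "\<dots> = (\<Sum>v<N. \<Sum>w<N. of_real (c v * c w) * (\<integral>x. \<psi> v x * cnj (\<psi> w x) \<partial>\<mu>))"
    unfolding sq
    by (simp add: Bochner_Integration.integral_sum Bochner_Integration.integrable_sum del: of_real_mult)
  also have "\<dots> = (\<Sum>v<N. of_real ((c v)\<^sup>2))"
  proof (rule sum.cong)
    fix v assume "v \<in> {..<N}"
    have "(\<Sum>w<N. complex_of_real (c v * c w) * (\<integral>x. \<psi> v x * cnj (\<psi> w x) \<partial>\<mu>))
        = (\<Sum>w<N. if v = w then complex_of_real ((c v)\<^sup>2) else 0)"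
      by (intro sum.cong) (auto simp: psi_orthonormal power2_eq_square)
    then show "(\<Sum>w<N. complex_of_real (c v * c w) * (\<integral>x. \<psi> v x * cnj (\<psi> w x) \<partial>\<mu>))
        = complex_of_real ((c v)\<^sup>2)"
      using \<open>v \<in> _\<close> by (simp add: sum.delta)
  qed simp
  also have "\<dots> = of_real (\<Sum>v<N. (c v)\<^sup>2)"
    by (rule of_real_sum[symmetric])
  finally show ?thesis
    by (rule of_real_eq_iff[THEN iffD1])
qed

lemma integrable_norm_sq_trig_poly [simp]:
  "integrable \<mu> (\<lambda>x. (norm (\<Sum>v<N. c v * \<psi> v x))\<^sup>2)"
proof (rule integrable_bounded_vilenkin[where B = "(\<Sum>v<N. norm (c v))\<^sup>2"])
  show "norm ((norm (\<Sum>v<N. c v * \<psi> v x))\<^sup>2) \<le> (\<Sum>v<N. norm (c v))\<^sup>2" for x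
    using sum_norm_le[of "{..<N}" "\<lambda>v. c v * \<psi> v x" "\<lambda>v. norm (c v)"]
    by (simp add: norm_mult power_mono)
qed measurable

text \<open>The kernel of a multiplier that is constant on blocks of length \<open>M i\<close> is a multiple of the
  Dirichlet kernel of order \<open>M i\<close>, hence supported on a set of measure \<open>1 / M i\<close>. By Parseval its
  squared \<open>L\<^sup>2\<close> norm is \<open>M i\<close> times the sum of the squared block values, and Cauchy--Schwarz on
  the support cancels the two powers of \<open>M i\<close>.\<close>

lemma block_kernel_L1:
  fixes d :: "nat \<Rightarrow> real"
  assumes "i \<le> K"
  shows "(\<integral>x. norm (\<Sum>v<M K. of_real (d (v div M i)) * \<psi> v x) \<partial>\<mu>)
           \<le> sqrt (\<Sum>a<M K div M i. (d a)\<^sup>2)"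
proof -
  define L where "L = M K div M i"
  have L: "M K = L * M i"
    using M_dvd[OF assms] by (simp add: L_def)
  define q where "q x = (\<Sum>v<M K. of_real (d (v div M i)) * \<psi> v x)" for x
  define S where "S = (\<Sum>a<L. (d a)\<^sup>2)"
  have q_factor: "q x = (\<Sum>a<L. of_real (d a) * \<psi> (a * M i) x) * dirichlet i x" for x
    unfolding q_def L sum_lessThan_blocks
    by (simp add: psi_split dirichlet_def sum_product mult.assoc)
  have S0: "0 \<le> S" by (simp add: S_def sum_nonneg)
  have q2: "(\<integral>x. (norm (q x))\<^sup>2 \<partial>\<mu>) = real (M i) * S"
    unfolding q_def parseval unfolding L sum_lessThan_blocks by (simp add: S_def sum_distrib_left)
  have [simp]: "integrable \<mu> (\<lambda>x. (norm (q x))\<^sup>2)" "integrable \<mu> q"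
    by (simp_all add: q_def[abs_def])
  have [simp]: "integrable \<mu> (\<lambda>x. norm (dirichlet i x))"
    using integrable_trig_poly[of "\<lambda>_. 1" "M i"] by (simp add: dirichlet_def)
  show ?thesis
  proof (cases "S = 0")
    case True
    then have "d a = 0" if "a < L" for a
      using that by (simp add: S_def sum_nonneg_eq_0_iff)
    then show ?thesis
      by (simp add: q_factor[unfolded q_def] L_def[symmetric])
  next
    case False
    \<comment> \<open>the weight that balances the two halves of the arithmetic-geometric mean inequality below\<close>
    define s where "s = 1 / (real (M i) * sqrt S)"
    have s: "s > 0" using False S0 by (simp add: s_def)
    have "norm (q x) \<le> (s * (norm (q x))\<^sup>2 + norm (dirichlet i x) / real (M i) / s) / 2"
      if "x \<in> G" for x
    proof (cases "\<forall>j<i. x j = 0")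
      case True
      have "0 \<le> (s * norm (q x) - 1)\<^sup>2" by simp
      then have "2 * s * norm (q x) \<le> s\<^sup>2 * (norm (q x))\<^sup>2 + 1"
        by (simp add: power2_eq_square algebra_simps)
      then have "2 * norm (q x) \<le> s * (norm (q x))\<^sup>2 + 1 / s"
        using s by (simp add: field_simps power2_eq_square)
      then show ?thesis
        using True by (simp add: dirichlet_eq[OF that])
    next
      case False
      then have "dirichlet i x = 0"
        using dirichlet_eq[OF that, of i] by argo
      then show ?thesis
        by (simp add: q_factor)
    qed
    then have "(\<integral>x. norm (q x) \<partial>\<mu>)
        \<le> (\<integral>x. (s * (norm (q x))\<^sup>2 + norm (dirichlet i x) / real (M i) / s) / 2 \<partial>\<mu>)"
      by (intro integral_mono) (auto simp: space_vilenkin_measure)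
    also have "\<dots> = (s * (real (M i) * S) + 1 / real (M i) / s) / 2"
      by (simp add: q2 integral_norm_dirichlet)
    also have "\<dots> = sqrt S"
      using S0 False by (simp add: s_def real_div_sqrt)
    finally show ?thesis
      by (simp add: q_def S_def L_def)
  qed
qed

text \<open>\<open>H i a\<close> stands for the value of an approximation of the multiplier \<open>H 0\<close> on the \<open>a\<close>-th block of
  length \<open>M i\<close>, and \<open>a div m i\<close> is the block of the next level containing block \<open>a\<close>. The difference
  of two consecutive approximations is constant on the blocks of the finer level.\<close>

lemma multiplier_L1_telescope:
  fixes H :: "nat \<Rightarrow> nat \<Rightarrow> real"
  shows "(\<integral>x. norm (\<Sum>v<M K. of_real (H 0 v) * \<psi> v x) \<partial>\<mu>)
           \<le> \<bar>H K 0\<bar> + (\<Sum>i<K. sqrt (\<Sum>a<M K div M i. (H i a - H (Suc i) (a div m i))\<^sup>2))"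
proof -
  define T where "T i x = (\<Sum>v<M K. of_real (H i (v div M i)) * \<psi> v x)" for i x
  define \<epsilon> where "\<epsilon> i = sqrt (\<Sum>a<M K div M i. (H i a - H (Suc i) (a div m i))\<^sup>2)" for i
  have int: "integrable \<mu> (\<lambda>x. norm (T i x))" "integrable \<mu> (T i)" for i
    by (simp_all add: T_def[abs_def])
  have step: "(\<integral>x. norm (T i x) \<partial>\<mu>) \<le> (\<integral>x. norm (T (Suc i) x) \<partial>\<mu>) + \<epsilon> i" if "i < K" for i
  proof -
    define d where "d a = H i a - H (Suc i) (a div m i)" for a
    have diff: "T i x - T (Suc i) x = (\<Sum>v<M K. of_real (d (v div M i)) * \<psi> v x)" for x
      by (simp add: T_def d_def sum_subtractf[symmetric] vilenkin_M_rec mult.commute[of "m i"]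
          div_mult2_eq left_diff_distrib)
    have "(\<integral>x. norm (T i x) \<partial>\<mu>) \<le> (\<integral>x. norm (T (Suc i) x) + norm (T i x - T (Suc i) x) \<partial>\<mu>)"
      using int norm_triangle_sub[of "T i _" "T (Suc i) _"] by (intro integral_mono) auto
    also have "\<dots> = (\<integral>x. norm (T (Suc i) x) \<partial>\<mu>) + (\<integral>x. norm (T i x - T (Suc i) x) \<partial>\<mu>)"
      using int by (intro Bochner_Integration.integral_add) auto
    also have "(\<integral>x. norm (T i x - T (Suc i) x) \<partial>\<mu>) \<le> \<epsilon> i"
      unfolding diff \<epsilon>_def using block_kernel_L1[of i K d] that by (simp add: d_def)
    finally show ?thesis by simp
  qed
  have "(\<integral>x. norm (T 0 x) \<partial>\<mu>) \<le> (\<integral>x. norm (T k x) \<partial>\<mu>) + (\<Sum>i<k. \<epsilon> i)" if "k \<le> K" for k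
    using that
  proof (induction k)
    case (Suc k)
    with step[of k] show ?case by simp
  qed simp
  from this[of K] have "(\<integral>x. norm (T 0 x) \<partial>\<mu>) \<le> (\<integral>x. norm (T K x) \<partial>\<mu>) + (\<Sum>i<K. \<epsilon> i)"
    by simp
  also have "(\<integral>x. norm (T K x) \<partial>\<mu>) \<le> \<bar>H K 0\<bar>"
    using block_kernel_L1[of K K "H K"] by (simp add: T_def)
  finally show ?thesis
    by (simp add: T_def \<epsilon>_def vilenkin_M_rec)
qed

text \<open>The approximation samples \<open>cesaro_A (-\<alpha>)\<close> at \<open>n - a * M i\<close>, but never at an argument below
  \<open>M i - 1\<close>. The cut-off keeps all values at level \<open>i\<close> below \<open>(M i) powr (-\<alpha>)\<close>, even on the blocks
  next to \<open>n\<close>, where the coefficients are of size \<open>1\<close>; subtracting \<open>1\<close> makes level \<open>0\<close> equal to the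
  multiplier itself. Since the values increase with \<open>a\<close> up to \<open>n\<close>, the differences between
  consecutive levels have absolute sum, and hence sum of squares, controlled by this maximum.\<close>

lemma cesaro_kernel_L1:
  assumes \<alpha>: "0 < \<alpha>" "\<alpha> < 1" and b: "\<And>k. m k \<le> b"
  shows "(\<integral>x. norm (\<Sum>v<M K. of_real (if v \<le> n then cesaro_A (-\<alpha>) (n - v) else 0) * \<psi> v x) \<partial>\<mu>)
           \<le> 1 + sqrt (2 * real b) / (1 - 2 powr (-\<alpha>))"
proof -
  let ?A = "cesaro_A (-\<alpha>)"
  note A_pos = cesaro_A_pos[OF \<alpha>] and A_anti = cesaro_A_antimono[OF \<alpha>]
  define H where "H i a = (if a * M i \<le> n then ?A (max (n - a * M i) (M i - 1)) else 0)" for i a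
  have H_nonneg: "0 \<le> H i a" for i a
    using A_pos by (simp add: H_def less_imp_le)
  have H_le: "H i a \<le> ?A (M i - 1)" for i a
    using A_pos A_anti by (simp add: H_def less_imp_le)
  have level: "(\<Sum>a<L. (H i a - H (Suc i) (a div m i))\<^sup>2) \<le> 2 * real b * (?A (M i - 1))\<^sup>2" for L i
  proof -
    define B where "B = ?A (M i - 1)"
    define N where "N = Suc (n div M i)"
    define t where "t a = H i a - H (Suc i) (a div m i)" for a
    define Y where "Y a = (if a < m i then 0 else H i (a - m i))" for a
    have N: "a < N \<longleftrightarrow> a * M i \<le> n" for a
      by (simp add: N_def less_Suc_eq_le less_eq_div_iff_mult_less_eq)
    have B0: "0 \<le> B" using A_pos by (simp add: B_def less_imp_le)
    have HS_le: "H (Suc i) c \<le> B" for c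
    proof -
      have "?A (M (Suc i) - 1) \<le> B"
        unfolding B_def using M_mono[of i "Suc i"] by (intro A_anti) simp
      with H_le[of "Suc i" c] show ?thesis by simp
    qed
    \<comment> \<open>up to \<open>n\<close>, monotonicity places the value of the parent block between the values at \<open>a - m i\<close>
      and \<open>a\<close>, so that the differences telescope with step \<open>m i\<close>\<close>
    have below: "(t a)\<^sup>2 \<le> B * (H i a - Y a)" if "a < N" for a
    proof -
      define c where "c = a div m i"
      have c: "c * M (Suc i) \<le> a * M i"
        by (simp add: c_def vilenkin_M_rec mult.assoc[symmetric])
      have le: "a * M i \<le> n" using that N by simp
      have "H (Suc i) c \<le> H i a"
        using c le M_mono[of i "Suc i"] by (auto simp: H_def intro!: A_anti)
      moreover have "Y a \<le> H (Suc i) c"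
      proof (cases "a < m i")
        case True
        then show ?thesis by (simp add: Y_def H_nonneg)
      next
        case False
        have "a - m i < c * m i"
          using False mod_less_divisor[OF m_pos, of a i] div_mult_mod_eq[of a "m i"]
          unfolding c_def by linarith
        then have 1: "(a - m i) * M i \<le> c * M (Suc i)"
          by (simp add: vilenkin_M_rec mult.assoc[symmetric])
        have 2: "(a - m i) * M i + M (Suc i) \<le> n"
          using le False by (simp add: vilenkin_M_rec add_mult_distrib[symmetric])
        have "max (n - c * M (Suc i)) (M (Suc i) - 1) \<le> max (n - (a - m i) * M i) (M i - 1)"
          using 1 2 by auto
        then show ?thesis
          using False 2 c le by (auto simp: Y_def H_def intro!: A_anti)
      qed
      ultimately have "0 \<le> t a" "t a \<le> B" "t a \<le> H i a - Y a"
        using H_le[of i a] H_nonneg[of "Suc i" c] by (auto simp: t_def c_def[symmetric] B_def)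
      then show ?thesis
        unfolding power2_eq_square by (intro mult_mono) auto
    qed
    \<comment> \<open>beyond \<open>n\<close>, only siblings of the block containing \<open>n\<close> contribute, and there are at most \<open>m i\<close>\<close>
    have above: "(t a)\<^sup>2 \<le> B\<^sup>2" "N + m i \<le> a \<Longrightarrow> t a = 0" if "\<not> a < N" for a
    proof -
      have t: "t a = - H (Suc i) (a div m i)"
        using that N by (simp add: t_def H_def)
      show "(t a)\<^sup>2 \<le> B\<^sup>2"
        unfolding t using HS_le H_nonneg by (simp add: power_mono)
      assume "N + m i \<le> a"
      then have "N \<le> a - m i" "m i \<le> a" by auto
      moreover have "a - m i \<le> a div m i * m i"
        using \<open>m i \<le> a\<close> mod_less_divisor[OF m_pos, of a i] div_mult_mod_eq[of a "m i"] by linarith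
      ultimately have "\<not> a div m i * m i < N" by linarith
      then have "\<not> a div m i * M (Suc i) \<le> n"
        by (simp add: N vilenkin_M_rec mult.assoc)
      then show "t a = 0" by (simp add: t H_def)
    qed
    have "(\<Sum>a<L. (t a)\<^sup>2) = (\<Sum>a\<in>{..<L} \<inter> {..<N + m i}. (t a)\<^sup>2)"
    proof (rule sum.mono_neutral_right)
      show "\<forall>a\<in>{..<L} - {..<L} \<inter> {..<N + m i}. (t a)\<^sup>2 = 0"
      proof
        fix a assume "a \<in> {..<L} - {..<L} \<inter> {..<N + m i}"
        then have "N + m i \<le> a" by auto
        then show "(t a)\<^sup>2 = 0" using above(2)[of a] by simp
      qed
    qed auto
    also have "\<dots> \<le> (\<Sum>a<N + m i. (t a)\<^sup>2)"
      by (intro sum_mono2) auto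
    also have "\<dots> = (\<Sum>a<N. (t a)\<^sup>2) + (\<Sum>a=N..<N + m i. (t a)\<^sup>2)"
      by (simp add: lessThan_atLeast0 sum.atLeastLessThan_concat)
    also have "(\<Sum>a=N..<N + m i. (t a)\<^sup>2) \<le> (\<Sum>a=N..<N + m i. B\<^sup>2)"
      using above(1) by (intro sum_mono) auto
    also have "(\<Sum>a<N. (t a)\<^sup>2) \<le> (\<Sum>a<N. B * (H i a - Y a))"
      using below by (intro sum_mono) auto
    also have "\<dots> = B * (\<Sum>a=N - m i..<N. H i a)"
      unfolding Y_def sum_distrib_left[symmetric] sum_shift_difference ..
    also have "(\<Sum>a=N - m i..<N. H i a) \<le> (\<Sum>a=N - m i..<N. B)"
      unfolding B_def by (intro sum_mono H_le)
    also have "(\<Sum>a=N - m i..<N. B) \<le> real (m i) * B"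
      using B0 by (simp add: mult_right_mono)
    also have "B * (real (m i) * B) + (\<Sum>a=N..<N + m i. B\<^sup>2) = 2 * real (m i) * B\<^sup>2"
      by (simp add: power2_eq_square)
    also have "\<dots> \<le> 2 * real b * B\<^sup>2"
      using b[of i] by (intro mult_right_mono) auto
    finally show ?thesis
      using B0 by (simp add: t_def B_def mult_left_mono add_mono)
  qed
  have H0: "H 0 v = (if v \<le> n then ?A (n - v) else 0)" for v
    by (simp add: H_def vilenkin_M_rec)
  have "sqrt (\<Sum>a<M K div M i. (H i a - H (Suc i) (a div m i))\<^sup>2)
      \<le> sqrt (2 * real b) * (2 powr (-\<alpha>)) ^ i" for i
  proof -
    have "sqrt (\<Sum>a<M K div M i. (H i a - H (Suc i) (a div m i))\<^sup>2)
        \<le> sqrt (2 * real b * (?A (M i - 1))\<^sup>2)"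
      using level by (rule real_sqrt_le_mono)
    also have "\<dots> = sqrt (2 * real b) * ?A (M i - 1)"
      using A_pos[of "M i - 1"] by (simp add: real_sqrt_mult)
    also have "?A (M i - 1) \<le> real (M i) powr (-\<alpha>)"
      using cesaro_A_le_powr[OF \<alpha>, of "M i - 1"] by simp
    also have "real (M i) powr (-\<alpha>) \<le> (2 ^ i) powr (-\<alpha>)"
    proof (rule powr_mono2')
      have "2 ^ i \<le> M i" using M_growth[of 0 i] by (simp add: vilenkin_M_rec)
      then show "2 ^ i \<le> real (M i)" by (metis of_nat_le_iff of_nat_numeral of_nat_power)
    qed (use \<alpha> in auto)
    also have "(2 ^ i) powr (-\<alpha>) = (2 powr (-\<alpha>)) ^ i"
      by (simp add: powr_realpow[symmetric] powr_powr mult.commute)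
    finally show ?thesis
      by (simp add: mult_left_mono)
  qed
  then have "(\<Sum>i<K. sqrt (\<Sum>a<M K div M i. (H i a - H (Suc i) (a div m i))\<^sup>2))
      \<le> (\<Sum>i<K. sqrt (2 * real b) * (2 powr (-\<alpha>)) ^ i)"
    by (intro sum_mono)
  also have "\<dots> = sqrt (2 * real b) * (\<Sum>i<K. (2 powr (-\<alpha>)) ^ i)"
    by (rule sum_distrib_left[symmetric])
  also have "(\<Sum>i<K. (2 powr (-\<alpha>)) ^ i) \<le> 1 / (1 - 2 powr (-\<alpha>))"
    using \<alpha> by (intro sum_geometric_le) (auto intro: powr_less_one)
  finally have sum: "(\<Sum>i<K. sqrt (\<Sum>a<M K div M i. (H i a - H (Suc i) (a div m i))\<^sup>2))
      \<le> sqrt (2 * real b) / (1 - 2 powr (-\<alpha>))"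
    by (simp add: mult_left_mono)
  have "\<bar>H K 0\<bar> \<le> 1"
    using H_nonneg[of K 0] H_le[of K 0] A_anti[of 0 "M K - 1"] by simp
  with sum multiplier_L1_telescope[of H K] show ?thesis
    by (simp only: H0) 
qed

text \<open>Sampling at left end points, the differences at level \<open>i\<close> are of order \<open>\<Lambda> * M i\<close> on
  \<open>M j / M i\<close> blocks, so their \<open>l\<^sup>2\<close> norm is of order \<open>\<Lambda> * sqrt (M i * M j)\<close>. This decays
  geometrically as \<open>i\<close> decreases from \<open>j\<close>, so the top levels dominate.\<close>

lemma lipschitz_multiplier_L1:
  fixes c :: "nat \<Rightarrow> real"
  assumes b: "\<And>k. m k \<le> b" and c0: "c 0 = 0" and "0 \<le> \<Lambda>"
    and lip: "\<And>v w. v \<le> w \<Longrightarrow> w < M j \<Longrightarrow> \<bar>c w - c v\<bar> \<le> \<Lambda> * real (w - v)"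
  shows "(\<integral>x. norm (\<Sum>v<M j. of_real (c v) * \<psi> v x) \<partial>\<mu>)
           \<le> real b * \<Lambda> / (1 - sqrt (1 / 2)) * real (M j)"
proof -
  define H where "H i a = c (a * M i)" for i a
  have level: "sqrt (\<Sum>a<M j div M i. (H i a - H (Suc i) (a div m i))\<^sup>2)
      \<le> real b * \<Lambda> * real (M j) * sqrt (1 / 2) ^ (j - Suc i)" if "i < j" for i
  proof -
    define L where "L = M j div M i"
    have L: "M j = L * M i"
      using M_dvd[of i j] that by (simp add: L_def)
    have term_le: "(H i a - H (Suc i) (a div m i))\<^sup>2 \<le> (real b * \<Lambda> * real (M i))\<^sup>2" if "a < L" for a
    proof -
      have eq: "a * M i - a div m i * M (Suc i) = (a mod m i) * M i"
        by (simp add: vilenkin_M_rec mult.assoc[symmetric] diff_mult_distrib[symmetric]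
            minus_div_mult_eq_mod)
      have "\<bar>H i a - H (Suc i) (a div m i)\<bar> \<le> \<Lambda> * real (a * M i - a div m i * M (Suc i))"
        unfolding H_def
      proof (rule lip)
        show "a div m i * M (Suc i) \<le> a * M i"
          by (simp add: vilenkin_M_rec mult.assoc[symmetric])
        show "a * M i < M j" using that L by simp
      qed
      also have "\<dots> = \<Lambda> * (real (a mod m i) * real (M i))"
        unfolding eq by simp
      also have "\<dots> \<le> \<Lambda> * (real b * real (M i))"
        using less_le_trans[OF mod_less_divisor[OF m_pos, of a i] b] \<open>0 \<le> \<Lambda>\<close>
        by (intro mult_left_mono mult_right_mono) auto
      finally have "\<bar>H i a - H (Suc i) (a div m i)\<bar> \<le> \<bar>real b * \<Lambda> * real (M i)\<bar>"
        using \<open>0 \<le> \<Lambda>\<close> by (simp add: mult_ac)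
      then show ?thesis by (rule abs_le_square_iff[THEN iffD1])
    qed
    have "M i * 2 ^ (j - i) \<le> M j"
      using M_growth[of i "j - i"] that by simp
    then have "real (M i) * 2 ^ (j - i) \<le> real (M j)"
      by (metis of_nat_le_iff of_nat_mult of_nat_numeral of_nat_power)
    then have Mi: "real (M i) \<le> real (M j) * (1 / 2) ^ (j - i)"
      by (simp add: field_simps)
    have "(\<Sum>a<L. (H i a - H (Suc i) (a div m i))\<^sup>2) \<le> real L * (real b * \<Lambda> * real (M i))\<^sup>2"
      using sum_mono[of "{..<L}", OF term_le] by simp
    also have "\<dots> = (real b * \<Lambda>)\<^sup>2 * real (M j) * real (M i)"
      by (simp add: L power2_eq_square)
    also have "\<dots> \<le> (real b * \<Lambda>)\<^sup>2 * real (M j) * (real (M j) * (1 / 2) ^ (j - i))"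
      using Mi by (intro mult_left_mono) auto
    also have "\<dots> = (real b * \<Lambda> * real (M j))\<^sup>2 * (1 / 2) ^ (j - i)"
      by (simp add: power2_eq_square)
    finally have "sqrt (\<Sum>a<L. (H i a - H (Suc i) (a div m i))\<^sup>2)
        \<le> sqrt ((real b * \<Lambda> * real (M j))\<^sup>2 * (1 / 2) ^ (j - i))"
      by (rule real_sqrt_le_mono)
    also have "\<dots> = real b * \<Lambda> * real (M j) * sqrt (1 / 2) ^ (j - i)"
      using \<open>0 \<le> \<Lambda>\<close>
      by (subst real_sqrt_mult) (simp add: real_sqrt_power[of _ "j - i"] abs_mult)
    also have "\<dots> \<le> real b * \<Lambda> * real (M j) * sqrt (1 / 2) ^ (j - Suc i)"
      using \<open>0 \<le> \<Lambda>\<close> by (intro mult_left_mono power_decreasing) auto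
    finally show ?thesis by (simp add: L_def)
  qed
  have "(\<Sum>i<j. sqrt (\<Sum>a<M j div M i. (H i a - H (Suc i) (a div m i))\<^sup>2))
      \<le> (\<Sum>i<j. real b * \<Lambda> * real (M j) * sqrt (1 / 2) ^ (j - Suc i))"
    using level by (intro sum_mono) auto
  also have "\<dots> = real b * \<Lambda> * real (M j) * (\<Sum>i<j. sqrt (1 / 2) ^ i)"
    by (simp add: sum.nat_diff_reindex[of "\<lambda>i. sqrt (1 / 2) ^ i"] sum_distrib_left[symmetric])
  also have "\<dots> \<le> real b * \<Lambda> * real (M j) * (1 / (1 - sqrt (1 / 2)))"
    using \<open>0 \<le> \<Lambda>\<close> by (intro mult_left_mono sum_geometric_le) (auto simp: real_sqrt_lt_1_iff)
  also have "\<dots> = real b * \<Lambda> / (1 - sqrt (1 / 2)) * real (M j)"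
    by simp
  finally show ?thesis
    using multiplier_L1_telescope[of H j] by (simp add: H_def c0 vilenkin_M_rec)
qed

section \<open>Norm bounds on the Vilenkin group\<close>

text \<open>The nonnegative integral makes a bound on the \<open>L\<^sup>p\<close> norm contain integrability, so that bounds can be
  added and averaged without side conditions. For \<open>p = \<infinity>\<close> the bound is required at every point
  and not only almost everywhere, in accordance with the supremum norm.\<close>

definition lp_bound :: "ennreal \<Rightarrow> ((nat \<Rightarrow> nat) \<Rightarrow> complex) \<Rightarrow> real \<Rightarrow> bool" where
  "lp_bound p u A \<longleftrightarrow> 0 \<le> A \<and> u \<in> borel_measurable \<mu> \<and>
     (if p = \<infinity> then \<forall>x\<in>G. norm (u x) \<le> A
      else (\<integral>\<^sup>+x. ennreal (norm (u x) powr enn2real p) \<partial>\<mu>) \<le> ennreal (A powr enn2real p))"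

lemma lp_bound_nonneg: "lp_bound p u A \<Longrightarrow> 0 \<le> A"
  by (simp add: lp_bound_def)

lemma lp_bound_measurable: "lp_bound p u A \<Longrightarrow> u \<in> borel_measurable \<mu>"
  by (simp add: lp_bound_def)

lemma zero_in_group: "(\<lambda>_. 0) \<in> G"
  by (simp add: group_iff)

lemma lp_bound_mono:
  assumes "lp_bound p u A" "A \<le> B"
  shows "lp_bound p u B"
proof -
  have "ennreal (A powr enn2real p) \<le> ennreal (B powr enn2real p)"
    using assms by (intro ennreal_leI powr_mono2) (auto simp: lp_bound_def)
  then show ?thesis
    using assms by (auto simp: lp_bound_def intro: order_trans[OF _ assms(2)] order_trans)
qed

lemma lp_bound_cong:
  assumes "\<And>x. x \<in> G \<Longrightarrow> u x = w x"
  shows "lp_bound p u A \<longleftrightarrow> lp_bound p w A"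
proof -
  have "u \<in> borel_measurable \<mu> \<longleftrightarrow> w \<in> borel_measurable \<mu>"
    using assms by (intro measurable_cong) (simp add: space_vilenkin_measure)
  moreover have "(\<integral>\<^sup>+x. ennreal (norm (u x) powr enn2real p) \<partial>\<mu>)
      = (\<integral>\<^sup>+x. ennreal (norm (w x) powr enn2real p) \<partial>\<mu>)"
    using assms by (intro nn_integral_cong) (simp add: space_vilenkin_measure)
  ultimately show ?thesis
    using assms by (simp add: lp_bound_def)
qed

lemma lp_bound_uminus:
  "lp_bound p u A \<Longrightarrow> lp_bound p (\<lambda>x. - u x) A"
  by (auto simp: lp_bound_def)

lemma lp_bound_translate:
  assumes "lp_bound p u A" "h \<in> G"
  shows "lp_bound p (\<lambda>x. u (x \<oplus> h)) A"
proof -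
  have [measurable]: "u \<in> borel_measurable \<mu>"
    using assms by (simp add: lp_bound_def)
  have "(\<lambda>x. u (x \<oplus> h)) \<in> borel_measurable \<mu>"
    using measurable_translate(1)[OF assms(2)] by (rule measurable_compose) simp
  moreover have "(\<integral>\<^sup>+x. ennreal (norm (u (x \<oplus> h)) powr enn2real p) \<partial>\<mu>)
      = (\<integral>\<^sup>+x. ennreal (norm (u x) powr enn2real p) \<partial>\<mu>)"
    by (rule nn_integral_translate[OF assms(2)]) measurable
  ultimately show ?thesis
    using assms by (simp add: lp_bound_def)
qed

lemma enn2real_ge_1:
  assumes "1 \<le> p" "p \<noteq> (\<infinity>::ennreal)"
  shows "1 \<le> enn2real p"
  using enn2real_mono[of 1 p] assms by (simp add: less_top)

lemma integrable_powr_of_lp_bound: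
  assumes "lp_bound p u A" "p \<noteq> \<infinity>"
  shows "integrable \<mu> (\<lambda>x. norm (u x) powr enn2real p)"
proof (rule integrableI_nonneg)
  have [measurable]: "u \<in> borel_measurable \<mu>" using assms by (simp add: lp_bound_def)
  show "(\<lambda>x. norm (u x) powr enn2real p) \<in> borel_measurable \<mu>" by measurable
  show "(\<integral>\<^sup>+x. ennreal (norm (u x) powr enn2real p) \<partial>\<mu>) < \<infinity>"
    using assms by (auto simp: lp_bound_def intro: le_less_trans)
qed simp

lemma vilenkin_norm_le:
  assumes "lp_bound p u A" "1 \<le> p"
  shows "vilenkin_norm m p u \<le> A"
proof (cases "p = \<infinity>")
  case True
  then show ?thesis
    using assms zero_in_group by (auto simp: vilenkin_norm_def lp_bound_def intro!: cSUP_least)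
next
  case False
  define r where "r = enn2real p"
  have r: "1 \<le> r" using enn2real_ge_1 assms False by (simp add: r_def)
  have "ennreal (\<integral>x. norm (u x) powr r \<partial>\<mu>) \<le> ennreal (A powr r)"
    using assms False integrable_powr_of_lp_bound[OF assms(1) False]
    by (simp add: lp_bound_def r_def nn_integral_eq_integral)
  then have "(\<integral>x. norm (u x) powr r \<partial>\<mu>) \<le> A powr r"
    by simp
  then have "(\<integral>x. norm (u x) powr r \<partial>\<mu>) powr (1 / r) \<le> (A powr r) powr (1 / r)"
    using r by (intro powr_mono2) auto
  also have "\<dots> = A"
    using r assms by (simp add: powr_powr lp_bound_def)
  finally show ?thesis
    using False by (simp add: vilenkin_norm_def r_def)
qed

text \<open>Some finite bound is needed as a hypothesis: without it, the Bochner integral and the supremum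
  in \<open>vilenkin_norm\<close> may take default values unrelated to the size of \<open>u\<close>.\<close>

lemma lp_bound_vilenkin_norm:
  assumes "lp_bound p u A" "1 \<le> p"
  shows "lp_bound p u (vilenkin_norm m p u)"
proof (cases "p = \<infinity>")
  case True
  then have bound: "norm (u x) \<le> A" if "x \<in> G" for x
    using assms that by (simp add: lp_bound_def)
  then have "norm (u x) \<le> vilenkin_norm m p u" if "x \<in> G" for x
    using that True by (auto simp: vilenkin_norm_def intro!: cSUP_upper bdd_aboveI2)
  moreover from this[OF zero_in_group] have "0 \<le> vilenkin_norm m p u"
    by (rule order_trans[rotated]) simp
  ultimately show ?thesis
    using assms True by (simp add: lp_bound_def)
next
  case False
  define r where "r = enn2real p"
  have r: "1 \<le> r" using enn2real_ge_1 assms False by (simp add: r_def)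
  have "(\<integral>\<^sup>+x. ennreal (norm (u x) powr r) \<partial>\<mu>) = ennreal (\<integral>x. norm (u x) powr r \<partial>\<mu>)"
    using integrable_powr_of_lp_bound[OF assms(1) False] by (simp add: r_def nn_integral_eq_integral)
  also have "(\<integral>x. norm (u x) powr r \<partial>\<mu>) = vilenkin_norm m p u powr r"
    using False r by (simp add: vilenkin_norm_def r_def[symmetric] powr_powr)
  finally show ?thesis
    using assms False by (simp add: lp_bound_def r_def vilenkin_norm_def)
qed

text \<open>Jensen's inequality for the probability density \<open>norm (q t) / Q\<close>. The tangent inequality is
  integrated at the point \<open>s = Z / Q\<close>, the value for which both sides of Jensen's inequality
  are compared. If \<open>q * w\<close> is not integrable, then \<open>Z\<close> is \<open>0\<close> and there is nothing to prove.\<close>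

lemma powr_norm_integral_le:
  fixes q w :: "'b \<Rightarrow> complex" and r :: real
  assumes r: "1 \<le> r" and q: "integrable N q" and [measurable]: "w \<in> borel_measurable N"
    and Q: "0 < (\<integral>t. norm (q t) \<partial>N)"
  shows "ennreal (norm (\<integral>t. q t * w t \<partial>N) powr r)
    \<le> ennreal ((\<integral>t. norm (q t) \<partial>N) powr (r - 1)) * (\<integral>\<^sup>+t. ennreal (norm (q t) * norm (w t) powr r) \<partial>N)"
proof -
  define Q where "Q = (\<integral>t. norm (q t) \<partial>N)"
  define Z where "Z = norm (\<integral>t. q t * w t \<partial>N)"
  define W where "W = (\<integral>\<^sup>+t. ennreal (norm (q t) * norm (w t) powr r) \<partial>N)"
  have Q0: "0 < Q" using Q by (simp add: Q_def)
  note [measurable] = borel_measurable_integrable[OF q]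
  show ?thesis
  proof (cases "Z = 0 \<or> W = \<infinity>")
    case True
    then show ?thesis
      using Q0 r unfolding Q_def[symmetric] Z_def[symmetric] W_def[symmetric]
      by (auto simp: ennreal_mult_top)
  next
    case False
    have Z0: "0 < Z" using False by (simp add: Z_def)
    have int_w: "integrable N (\<lambda>t. norm (q t) * norm (w t) powr r)"
      using False by (intro integrableI_nonneg) (auto simp: W_def less_top)
    define I where "I = (\<integral>t. norm (q t) * norm (w t) powr r \<partial>N)"
    have W_eq: "W = ennreal I"
      unfolding W_def I_def using int_w by (intro nn_integral_eq_integral) auto
    define s where "s = Z / Q"
    have s0: "0 < s" using Z0 Q0 by (simp add: s_def)
    have "Z \<le> (\<integral>t. norm (q t * w t) \<partial>N)"
      unfolding Z_def by (rule integral_norm_bound)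
    also have "\<dots> \<le> (\<integral>t. (1 - 1 / r) * s * norm (q t)
        + 1 / r * s powr (1 - r) * (norm (q t) * norm (w t) powr r) \<partial>N)"
    proof (rule integral_mono')
      show "integrable N (\<lambda>t. (1 - 1 / r) * s * norm (q t)
        + 1 / r * s powr (1 - r) * (norm (q t) * norm (w t) powr r))"
        using q int_w by (intro Bochner_Integration.integrable_add integrable_mult_right integrable_norm)
      show "norm (q t * w t) \<le> (1 - 1 / r) * s * norm (q t)
        + 1 / r * s powr (1 - r) * (norm (q t) * norm (w t) powr r)" for t
        using mult_left_mono[OF powr_tangent[OF r s0, of "norm (w t)"], of "norm (q t)"]
        by (simp add: norm_mult algebra_simps)
      show "0 \<le> (1 - 1 / r) * s * norm (q t)
        + 1 / r * s powr (1 - r) * (norm (q t) * norm (w t) powr r)" for t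
        using r s0 by simp
    qed
    also have "\<dots> = (1 - 1 / r) * s * Q + 1 / r * s powr (1 - r) * I"
      unfolding Q_def I_def using q int_w
      by (subst Bochner_Integration.integral_add) auto
    finally have "Z \<le> (1 - 1 / r) * Z + 1 / r * (s powr (1 - r) * I)"
      using Q0 by (simp add: s_def)
    then have "Z \<le> s powr (1 - r) * I"
      using r by (simp add: field_simps)
    then have "Z * (Z powr (r - 1) * Q powr (r - 1))
        \<le> (s powr (1 - r) * I) * (Z powr (r - 1) * Q powr (r - 1))"
      by (rule mult_right_mono) simp
    moreover have "s powr (1 - r) * Z powr (r - 1) = Q powr (r - 1)"
    proof -
      have "s powr (1 - r) = Z powr (1 - r) / Q powr (1 - r)"
        using Z0 Q0 by (simp add: s_def powr_divide)
      moreover have "Z powr (1 - r) * Z powr (r - 1) = 1" "Q powr (r - 1) = 1 / Q powr (1 - r)"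
        using Z0 powr_minus_divide[of Q "1 - r"] by (simp_all add: powr_add[symmetric])
      ultimately show ?thesis
        by simp
    qed
    ultimately have "Z * Z powr (r - 1) * Q powr (r - 1) \<le> Q powr (r - 1) * I * Q powr (r - 1)"
      by (simp add: mult_ac)
    moreover have "Z * Z powr (r - 1) = Z powr r"
      using Z0 powr_add[of Z 1 "r - 1"] by simp
    ultimately have "Z powr r \<le> Q powr (r - 1) * I"
      using Q0 by (simp add: mult.commute)
    then show ?thesis
      unfolding Q_def[symmetric] Z_def[symmetric] W_def[symmetric] W_eq
      by (simp add: ennreal_mult'[symmetric] ennreal_leI)
  qed
qed

text \<open>Minkowski's integral inequality. For finite \<open>p\<close> it is Jensen's inequality for each \<open>x\<close>, integrated
  in \<open>x\<close> by Tonelli. The bound on \<open>F\<close> is required only where \<open>q\<close> does not vanish, so that the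
  support of a kernel can be exploited.\<close>

lemma lp_bound_integral:
  fixes F :: "(nat \<Rightarrow> nat) \<Rightarrow> (nat \<Rightarrow> nat) \<Rightarrow> complex"
  assumes p: "1 \<le> p" and q: "integrable \<mu> q" and "0 \<le> B"
    and F [measurable]: "case_prod F \<in> borel_measurable (\<mu> \<Otimes>\<^sub>M \<mu>)"
    and bound: "\<And>t. t \<in> G \<Longrightarrow> q t \<noteq> 0 \<Longrightarrow> lp_bound p (\<lambda>x. F x t) B"
  shows "lp_bound p (\<lambda>x. \<integral>t. q t * F x t \<partial>\<mu>) ((\<integral>t. norm (q t) \<partial>\<mu>) * B)"
proof -
  define Q where "Q = (\<integral>t. norm (q t) \<partial>\<mu>)"
  have Q0: "0 \<le> Q" by (simp add: Q_def)
  note [measurable] = borel_measurable_integrable[OF q]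
  have [measurable]: "(\<lambda>x. \<integral>t. q t * F x t \<partial>\<mu>) \<in> borel_measurable \<mu>"
    by measurable
  show ?thesis
  proof (cases "p = \<infinity>")
    case True
    have "norm (\<integral>t. q t * F x t \<partial>\<mu>) \<le> Q * B" if "x \<in> G" for x
    proof -
      have "norm (\<integral>t. q t * F x t \<partial>\<mu>) \<le> (\<integral>t. norm (q t * F x t) \<partial>\<mu>)"
        by (rule integral_norm_bound)
      also have "\<dots> \<le> (\<integral>t. norm (q t) * B \<partial>\<mu>)"
      proof (rule integral_mono')
        fix t assume "t \<in> space \<mu>"
        then show "norm (q t * F x t) \<le> norm (q t) * B"
          using bound[of t] that True
          by (cases "q t = 0") (auto simp: lp_bound_def norm_mult space_vilenkin_measure mult_left_mono)
      qed (use q \<open>0 \<le> B\<close> in auto)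
      finally show ?thesis by (simp add: Q_def)
    qed
    then show ?thesis
      using True Q0 \<open>0 \<le> B\<close> by (simp add: lp_bound_def Q_def)
  next
    case False
    define r where "r = enn2real p"
    have r: "1 \<le> r" using enn2real_ge_1 p False by (simp add: r_def)
    have "(\<integral>\<^sup>+x. ennreal (norm (\<integral>t. q t * F x t \<partial>\<mu>) powr r) \<partial>\<mu>) \<le> ennreal ((Q * B) powr r)"
    proof (cases "Q = 0")
      case True
      then have "AE t in \<mu>. q t = 0"
        using q integral_nonneg_eq_0_iff_AE[of \<mu> "\<lambda>t. norm (q t)"] by (simp add: Q_def)
      then have "(\<integral>t. q t * F x t \<partial>\<mu>) = 0" for x
        by (intro integral_eq_zero_AE) auto
      then show ?thesis using r by simp
    next
      case False
      with Q0 have Q_pos: "0 < Q" by simp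
      interpret pair: pair_sigma_finite \<mu> \<mu> ..
      have "(\<integral>\<^sup>+x. ennreal (norm (\<integral>t. q t * F x t \<partial>\<mu>) powr r) \<partial>\<mu>)
          \<le> (\<integral>\<^sup>+x. ennreal (Q powr (r - 1)) * (\<integral>\<^sup>+t. ennreal (norm (q t) * norm (F x t) powr r) \<partial>\<mu>) \<partial>\<mu>)"
      proof (rule nn_integral_mono)
        fix x assume x: "x \<in> space \<mu>"
        have "F x \<in> borel_measurable \<mu>"
          using measurable_compose[OF measurable_Pair1'[OF x] F] by simp
        with powr_norm_integral_le[OF r q this] Q_pos
        show "ennreal (norm (\<integral>t. q t * F x t \<partial>\<mu>) powr r)
          \<le> ennreal (Q powr (r - 1)) * (\<integral>\<^sup>+t. ennreal (norm (q t) * norm (F x t) powr r) \<partial>\<mu>)"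
          by (simp add: Q_def)
      qed
      also have "\<dots> = ennreal (Q powr (r - 1)) *
          (\<integral>\<^sup>+x. (\<integral>\<^sup>+t. ennreal (norm (q t) * norm (F x t) powr r) \<partial>\<mu>) \<partial>\<mu>)"
        by (rule nn_integral_cmult) measurable
      also have "(\<integral>\<^sup>+x. (\<integral>\<^sup>+t. ennreal (norm (q t) * norm (F x t) powr r) \<partial>\<mu>) \<partial>\<mu>)
          = (\<integral>\<^sup>+t. (\<integral>\<^sup>+x. ennreal (norm (q t) * norm (F x t) powr r) \<partial>\<mu>) \<partial>\<mu>)"
        using pair.Fubini[of "\<lambda>z. ennreal (norm (q (snd z)) * norm (F (fst z) (snd z)) powr r)"]
        by simp
      also have "\<dots> \<le> (\<integral>\<^sup>+t. ennreal (norm (q t) * B powr r) \<partial>\<mu>)"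
      proof (rule nn_integral_mono)
        fix t assume t: "t \<in> space \<mu>"
        show "(\<integral>\<^sup>+x. ennreal (norm (q t) * norm (F x t) powr r) \<partial>\<mu>) \<le> ennreal (norm (q t) * B powr r)"
        proof (cases "q t = 0")
          case False
          then have b: "lp_bound p (\<lambda>x. F x t) B"
            using bound t by (simp add: space_vilenkin_measure)
          note [measurable] = lp_bound_measurable[OF b]
          have "(\<integral>\<^sup>+x. ennreal (norm (q t) * norm (F x t) powr r) \<partial>\<mu>)
              = ennreal (norm (q t)) * (\<integral>\<^sup>+x. ennreal (norm (F x t) powr r) \<partial>\<mu>)"
            by (simp add: ennreal_mult nn_integral_cmult)
          also have "\<dots> \<le> ennreal (norm (q t)) * ennreal (B powr r)"
            using b \<open>p \<noteq> \<infinity>\<close> by (intro mult_left_mono) (auto simp: lp_bound_def r_def)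
          finally show ?thesis by (simp add: ennreal_mult)
        qed simp
      qed
      also have "(\<integral>\<^sup>+t. ennreal (norm (q t) * B powr r) \<partial>\<mu>) = ennreal (Q * B powr r)"
        using q by (subst nn_integral_eq_integral) (auto simp: Q_def)
      also have "ennreal (Q powr (r - 1)) * ennreal (Q * B powr r) = ennreal ((Q * B) powr r)"
      proof -
        have "Q powr (r - 1) * Q = Q powr r"
          using Q_pos powr_add[of Q "r - 1" 1] by simp
        then have "Q powr (r - 1) * (Q * B powr r) = (Q * B) powr r"
          using Q0 \<open>0 \<le> B\<close> by (simp add: powr_mult mult.assoc[symmetric])
        then show ?thesis
          using Q0 by (simp add: ennreal_mult'[symmetric])
      qed
      finally show ?thesis
        by (simp add: mult_left_mono)
    qed
    then show ?thesis
      using False Q0 \<open>0 \<le> B\<close> by (simp add: lp_bound_def Q_def r_def)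
  qed
qed

text \<open>Convexity of the \<open>r\<close>-th power with weights \<open>A / (A + B)\<close> and \<open>B / (A + B)\<close>, applied to \<open>a / A\<close>
  and \<open>b / B\<close>. Integrated with \<open>A\<close> and \<open>B\<close> the norms of the summands it gives the triangle
  inequality.\<close>

lemma powr_add_le:
  fixes a b A B r :: real
  assumes r: "1 \<le> r" and "0 \<le> a" "0 \<le> b" "0 < A" "0 < B"
  shows "(a + b) powr r
    \<le> (A + B) powr (r - 1) * (A powr (1 - r) * a powr r + B powr (1 - r) * b powr r)"
proof (cases "a + b = 0")
  case False
  define s where "s = (a + b) / (A + B)"
  define X where "X = A powr (1 - r) * a powr r + B powr (1 - r) * b powr r"
  have s: "0 < s" using False assms by (simp add: s_def)
  have sAB: "A * s + B * s = a + b"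
  proof -
    have "A * s + B * s = (A + B) * s" by (rule distrib_right[symmetric])
    then show ?thesis using assms by (simp add: s_def)
  qed
  have "a \<le> (1 - 1 / r) * (A * s) + 1 / r * ((A * s) powr (1 - r) * a powr r)"
    "b \<le> (1 - 1 / r) * (B * s) + 1 / r * ((B * s) powr (1 - r) * b powr r)"
    using powr_tangent[of r "A * s" a] powr_tangent[of r "B * s" b] assms s by simp_all
  then have "a + b \<le> (1 - 1 / r) * (A * s + B * s) + 1 / r * (s powr (1 - r) * X)"
    using assms s by (simp add: X_def powr_mult algebra_simps)
  then have "a + b \<le> s powr (1 - r) * X"
    unfolding sAB using r by (simp add: field_simps)
  then have "(a + b) * s powr (r - 1) \<le> s powr (1 - r) * X * s powr (r - 1)"
    by (rule mult_right_mono) simp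
  also have "\<dots> = X"
    using s by (simp add: powr_add[symmetric])
  finally have "(a + b) * s powr (r - 1) \<le> X" .
  moreover have "(a + b) powr r = (A + B) powr (r - 1) * ((a + b) * s powr (r - 1))"
  proof -
    have "(A + B) powr (r - 1) * s powr (r - 1) = (a + b) powr (r - 1)"
      using assms s by (simp add: powr_mult[symmetric] s_def)
    moreover have "(a + b) * (a + b) powr (r - 1) = (a + b) powr r"
      using powr_add[of "a + b" 1 "r - 1"] assms False by simp
    ultimately show ?thesis by (simp add: mult.left_commute)
  qed
  ultimately show ?thesis
    by (simp add: X_def mult_left_mono)
qed (use assms in auto)

lemma lp_bound_zeroD:
  assumes "lp_bound p u 0" "1 \<le> p" "p \<noteq> \<infinity>"
  shows "AE x in \<mu>. u x = 0"
proof -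
  have [measurable]: "u \<in> borel_measurable \<mu>" using assms by (simp add: lp_bound_def)
  have "(\<integral>\<^sup>+x. ennreal (norm (u x) powr enn2real p) \<partial>\<mu>) = 0"
    using assms enn2real_ge_1[of p] by (simp add: lp_bound_def)
  then have "AE x in \<mu>. ennreal (norm (u x) powr enn2real p) = 0"
    by (subst (asm) nn_integral_0_iff_AE) auto
  then show ?thesis
    by eventually_elim (simp add: ennreal_eq_0_iff not_less[symmetric])
qed

lemma lp_bound_cong_AE:
  assumes "lp_bound p u A" "p \<noteq> \<infinity>" "AE x in \<mu>. w x = u x" "w \<in> borel_measurable \<mu>"
  shows "lp_bound p w A"
proof -
  have "(\<integral>\<^sup>+x. ennreal (norm (w x) powr enn2real p) \<partial>\<mu>)
      = (\<integral>\<^sup>+x. ennreal (norm (u x) powr enn2real p) \<partial>\<mu>)"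
    using assms(3) by (intro nn_integral_cong_AE) auto
  then show ?thesis using assms by (simp add: lp_bound_def)
qed

lemma lp_bound_add:
  assumes u: "lp_bound p u A" and w: "lp_bound p w B" and p: "1 \<le> p"
  shows "lp_bound p (\<lambda>x. u x + w x) (A + B)"
proof -
  note [measurable] = lp_bound_measurable[OF u] lp_bound_measurable[OF w]
  have nonneg: "0 \<le> A" "0 \<le> B" using u w by (auto simp: lp_bound_def)
  show ?thesis
  proof (cases "p = \<infinity>")
    case True
    then show ?thesis
      using u w by (auto simp: lp_bound_def intro: order_trans[OF norm_triangle_ineq add_mono])
  next
    case False
    show ?thesis
    proof (cases "A = 0 \<or> B = 0")
      case True
      then show ?thesis
      proof
        assume "A = 0"
        with lp_bound_zeroD[of p u] u p False have "AE x in \<mu>. u x = 0" by simp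
        then have "AE x in \<mu>. u x + w x = w x" by eventually_elim simp
        then show ?thesis
          using lp_bound_cong_AE[OF w False, of "\<lambda>x. u x + w x"] \<open>A = 0\<close> by simp
      next
        assume "B = 0"
        with lp_bound_zeroD[of p w] w p False have "AE x in \<mu>. w x = 0" by simp
        then have "AE x in \<mu>. u x + w x = u x" by eventually_elim simp
        then show ?thesis
          using lp_bound_cong_AE[OF u False, of "\<lambda>x. u x + w x"] \<open>B = 0\<close> by simp
      qed
    next
      case nz: False
      define r where "r = enn2real p"
      have r: "1 \<le> r" using enn2real_ge_1 p False by (simp add: r_def)
      have pos: "0 < A" "0 < B" using nz nonneg by auto
      define U where "U = (\<integral>x. norm (u x) powr r \<partial>\<mu>)"
      define V where "V = (\<integral>x. norm (w x) powr r \<partial>\<mu>)"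
      have int: "integrable \<mu> (\<lambda>x. norm (u x) powr r)" "integrable \<mu> (\<lambda>x. norm (w x) powr r)"
        using integrable_powr_of_lp_bound u w False by (auto simp: r_def)
      have "ennreal U \<le> ennreal (A powr r)" "ennreal V \<le> ennreal (B powr r)"
        using u w False int unfolding U_def V_def r_def
        by (auto simp: lp_bound_def nn_integral_eq_integral)
      then have UV: "U \<le> A powr r" "V \<le> B powr r" by simp_all
      have "(\<integral>\<^sup>+x. ennreal (norm (u x + w x) powr r) \<partial>\<mu>)
        \<le> (\<integral>\<^sup>+x. ennreal ((A + B) powr (r - 1) * (A powr (1 - r) * norm (u x) powr r
              + B powr (1 - r) * norm (w x) powr r)) \<partial>\<mu>)"
      proof (intro nn_integral_mono ennreal_leI)
        fix x
        have "norm (u x + w x) powr r \<le> (norm (u x) + norm (w x)) powr r"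
          using r by (intro powr_mono2 norm_triangle_ineq) auto
        also have "\<dots> \<le> (A + B) powr (r - 1) * (A powr (1 - r) * norm (u x) powr r
              + B powr (1 - r) * norm (w x) powr r)"
          using r pos by (intro powr_add_le) auto
        finally show "norm (u x + w x) powr r \<le> (A + B) powr (r - 1) * (A powr (1 - r) * norm (u x) powr r
              + B powr (1 - r) * norm (w x) powr r)" .
      qed
      also have "\<dots> = ennreal ((A + B) powr (r - 1) * (A powr (1 - r) * U + B powr (1 - r) * V))"
        using int by (subst nn_integral_eq_integral) (auto simp: U_def V_def)
      also have "\<dots> \<le> ennreal ((A + B) powr (r - 1)
          * (A powr (1 - r) * A powr r + B powr (1 - r) * B powr r))"
        using UV by (intro ennreal_leI mult_left_mono add_mono) auto
      also have "A powr (1 - r) * A powr r + B powr (1 - r) * B powr r = A + B"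
        using pos by (simp add: powr_add[symmetric])
      also have "(A + B) powr (r - 1) * (A + B) = (A + B) powr r"
        using pos powr_add[of "A + B" "r - 1" 1] by simp
      finally show ?thesis
        using False nonneg by (simp add: lp_bound_def r_def)
    qed
  qed
qed

lemma lp_bound_zero: "lp_bound p (\<lambda>x. 0) 0"
  by (simp add: lp_bound_def)

lemma lp_bound_sum:
  assumes "1 \<le> p" "finite J" "\<And>i. i \<in> J \<Longrightarrow> lp_bound p (u i) (A i)"
  shows "lp_bound p (\<lambda>x. \<Sum>i\<in>J. u i x) (\<Sum>i\<in>J. A i)"
  using assms(2,3)
proof (induction J rule: finite_induct)
  case (insert j J)
  then show ?case
    using lp_bound_add[of p "u j" "A j" "\<lambda>x. \<Sum>i\<in>J. u i x" "\<Sum>i\<in>J. A i"] assms(1) by simp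
qed (simp add: lp_bound_zero)

text \<open>Boundedness is compactness of the group. Measurability for the product sigma-algebra holds because
  \<open>f x\<close> is the limit of the values of \<open>f\<close> at the truncations of \<open>x\<close>, and these are functions of
  finitely many coordinates.\<close>

lemma continuous_imp_lp_bound:
  assumes f: "continuous_map (vilenkin_topology m) euclidean f"
  shows "\<exists>A. lp_bound \<infinity> f A"
proof -
  have "compact_space (vilenkin_topology m)"
    by (simp add: vilenkin_topology_def compact_space_product_topology compact_space_discrete_topology)
  then have "compactin euclidean (f ` topspace (vilenkin_topology m))"
    unfolding compact_space_def using f by (rule image_compactin)
  then have "bounded (f ` G)"
    by (simp add: topspace_vilenkin_topology compact_imp_bounded)
  then obtain A where A: "\<forall>x\<in>G. norm (f x) \<le> A"
    by (auto simp: bounded_iff)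
  define trunc where "trunc j x = (\<lambda>k. if k < j then x k else 0)" for j :: nat and x :: "nat \<Rightarrow> nat"
  have trunc_G: "trunc j x \<in> G" if "x \<in> G" for j x
    using that by (simp add: trunc_def group_iff)
  have "(\<lambda>x. f (trunc j x)) \<in> borel_measurable \<mu>" for j
  proof -
    have "(\<lambda>x. map x [0..<j]) \<in> \<mu> \<rightarrow>\<^sub>M count_space UNIV"
    proof (induction j)
      case (Suc j)
      have "(\<lambda>x. (\<lambda>l. l @ [x j]) (map x [0..<j])) \<in> \<mu> \<rightarrow>\<^sub>M count_space UNIV"
      proof (rule measurable_compose_countable[OF _ Suc])
        show "(\<lambda>x. l @ [x j]) \<in> \<mu> \<rightarrow>\<^sub>M count_space UNIV" for l :: "nat list"
          by (rule measurable_compose[where g = "\<lambda>c. l @ [c]", OF measurable_coordinate]) simp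
      qed
      then show ?case by simp
    qed simp
    then have "(\<lambda>x. (\<lambda>l. f (\<lambda>k. if k < j then l ! k else 0)) (map x [0..<j])) \<in> borel_measurable \<mu>"
      by (rule measurable_compose) simp
    also have "(\<lambda>x. (\<lambda>l. f (\<lambda>k. if k < j then l ! k else 0)) (map x [0..<j])) = (\<lambda>x. f (trunc j x))"
      by (intro ext arg_cong[where f = f]) (auto simp: trunc_def)
    finally show ?thesis .
  qed
  moreover have "(\<lambda>j. f (trunc j x)) \<longlonglongrightarrow> f x" if "x \<in> space \<mu>" for x
  proof -
    have x: "x \<in> G" using that by (simp add: space_vilenkin_measure)
    have "limitin (vilenkin_topology m) (\<lambda>j. trunc j x) x sequentially"
      unfolding vilenkin_topology_def limitin_componentwise
    proof (intro conjI ballI)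
      show "\<forall>\<^sub>F j in sequentially. trunc j x \<in> topspace (product_topology (\<lambda>k. discrete_topology {..<m k}) UNIV)"
        using trunc_G[OF x] by (simp add: vilenkin_group_def)
      fix k
      have "\<forall>\<^sub>F j in sequentially. trunc j x k = x k"
        using eventually_gt_at_top[of k] by eventually_elim (simp add: trunc_def)
      then show "limitin (discrete_topology {..<m k}) (\<lambda>j. trunc j x k) (x k) sequentially"
        using x by (auto simp: limitin_def group_iff elim: eventually_mono)
    qed simp
    from continuous_map_limit[OF f this] show ?thesis
      by (simp add: o_def)
  qed
  ultimately have "f \<in> borel_measurable \<mu>"
    by (rule borel_measurable_LIMSEQ_metric)
  moreover have "0 \<le> A"
    using A zero_in_group norm_ge_zero order_trans by blast
  ultimately show ?thesis
    using A by (auto simp: lp_bound_def)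
qed

lemma vilenkin_Lp_lp_bound:
  assumes "f \<in> vilenkin_Lp m p" "1 \<le> p"
  shows "\<exists>A. lp_bound p f A"
proof (cases "p = \<infinity>")
  case True
  then show ?thesis
    using assms continuous_imp_lp_bound[of f] by (simp add: vilenkin_Lp_def)
next
  case False
  define r where "r = enn2real p"
  have r: "1 \<le> r" using enn2real_ge_1 assms False by (simp add: r_def)
  have f: "f \<in> borel_measurable \<mu>" "integrable \<mu> (\<lambda>x. norm (f x) powr r)"
    using assms False by (auto simp: vilenkin_Lp_def r_def)
  define I where "I = (\<integral>x. norm (f x) powr r \<partial>\<mu>)"
  have "(\<integral>\<^sup>+x. ennreal (norm (f x) powr r) \<partial>\<mu>) = ennreal I"
    unfolding I_def using f by (intro nn_integral_eq_integral) auto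
  also have "I = (I powr (1 / r)) powr r"
    using r by (simp add: powr_powr I_def)
  finally have "lp_bound p f (I powr (1 / r))"
    using f False by (simp add: lp_bound_def r_def)
  then show ?thesis ..
qed

lemma lp_bound_integrable:
  assumes f: "lp_bound p f A" and p: "1 \<le> p"
  shows "integrable \<mu> f"
proof (cases "p = \<infinity>")
  case True
  then have "AE x in \<mu>. norm (f x) \<le> A"
    using f by (intro AE_I2) (simp add: lp_bound_def space_vilenkin_measure)
  then show ?thesis
    using f by (intro haar.integrable_const_bound) (auto simp: lp_bound_def)
next
  case False
  have r: "1 \<le> enn2real p" using enn2real_ge_1 p False by simp
  have "integrable \<mu> (\<lambda>x. 1 + norm (f x) powr enn2real p)"
    using integrable_powr_of_lp_bound[OF f False] by simp
  then show ?thesis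
  proof (rule Bochner_Integration.integrable_bound)
    show "AE x in \<mu>. norm (f x) \<le> norm (1 + norm (f x) powr enn2real p)"
    proof (rule AE_I2)
      fix x
      show "norm (f x) \<le> norm (1 + norm (f x) powr enn2real p)"
      proof (cases "norm (f x) \<le> 1")
        case False
        then have "norm (f x) powr 1 \<le> norm (f x) powr enn2real p"
          using r by (intro powr_mono) auto
        then show ?thesis using False by simp
      qed (simp add: add_increasing2)
    qed
  qed (use lp_bound_measurable[OF f] in simp)
qed

text \<open>The supremum defining the modulus is a true bound because the norms of the differences are bounded
  uniformly in \<open>h\<close>, by twice a bound for \<open>f\<close>.\<close>

lemma lp_bound_modulus:
  assumes f: "f \<in> vilenkin_Lp m p" and p: "1 \<le> p" and h: "h \<in> vilenkin_I m n"
  shows "lp_bound p (\<lambda>x. f (x \<oplus> h) - f x) (vilenkin_modulus m p n f)"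
proof -
  obtain A where A: "lp_bound p f A" using vilenkin_Lp_lp_bound[OF f p] ..
  have diff: "lp_bound p (\<lambda>x. f (x \<oplus> h) - f x) (A + A)" if "h \<in> vilenkin_I m n" for h
    using lp_bound_add[OF lp_bound_translate[OF A] lp_bound_uminus[OF A] p, of h] that
    by (simp add: vilenkin_I_def)
  then have "vilenkin_norm m p (\<lambda>x. f (x \<oplus> h) - f x) \<le> vilenkin_modulus m p n f"
    unfolding vilenkin_modulus_def
    by (intro cSUP_upper h bdd_aboveI2 vilenkin_norm_le[OF _ p])
  then show ?thesis
    using lp_bound_vilenkin_norm[OF diff[OF h] p] by (rule lp_bound_mono[rotated])
qed

section \<open>Fourier multipliers\<close>

lemma integrable_translate:
  fixes f :: "(nat \<Rightarrow> nat) \<Rightarrow> complex"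
  assumes "integrable \<mu> f" "h \<in> G"
  shows "integrable \<mu> (\<lambda>x. f (x \<oplus> h))"
  using integrable_distr[OF measurable_translate(1)[OF assms(2)], of f] assms
  by (simp add: distr_translate)

lemma integrable_mult_cnj_psi:
  assumes "integrable \<mu> f"
  shows "integrable \<mu> (\<lambda>x. f x * cnj (\<psi> v x))"
proof (rule Bochner_Integration.integrable_bound[OF assms])
  note [measurable] = borel_measurable_integrable[OF assms]
  show "(\<lambda>x. f x * cnj (\<psi> v x)) \<in> borel_measurable \<mu>" by measurable
qed (simp add: norm_mult)

text \<open>Substituting \<open>x \<oplus> t\<close> for the integration variable, with \<open>x\<close> fixed, writes the Fourier term as a
  correlation with a character; the translates \<open>f (x \<oplus> t)\<close> are the ones in the modulus of continuity.\<close>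

lemma fourier_mult_psi:
  assumes f: "integrable \<mu> f" and x: "x \<in> G"
  shows "vilenkin_fourier m f v * \<psi> v x = (\<integral>t. cnj (\<psi> v t) * f (x \<oplus> t) \<partial>\<mu>)"
proof -
  note [measurable] = borel_measurable_integrable[OF f]
  have "vilenkin_fourier m f v = (\<integral>t. f (t \<oplus> x) * cnj (\<psi> v (t \<oplus> x)) \<partial>\<mu>)"
    unfolding vilenkin_fourier_def
    by (rule integral_translate[OF x, symmetric]) measurable
  also have "\<dots> = (\<integral>t. cnj (\<psi> v x) * (cnj (\<psi> v t) * f (x \<oplus> t)) \<partial>\<mu>)"
    by (simp add: psi_add add_commute mult_ac)
  also have "\<dots> = cnj (\<psi> v x) * (\<integral>t. cnj (\<psi> v t) * f (x \<oplus> t) \<partial>\<mu>)"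
    by simp
  finally show ?thesis
    using psi_cnj[of v x] by (simp add: mult_ac)
qed

definition multiplier :: "nat \<Rightarrow> (nat \<Rightarrow> real) \<Rightarrow> ((nat \<Rightarrow> nat) \<Rightarrow> complex) \<Rightarrow> (nat \<Rightarrow> nat) \<Rightarrow> complex" where
  "multiplier N c f x = (\<Sum>v<N. of_real (c v) * (vilenkin_fourier m f v * \<psi> v x))"

lemma multiplier_eq_integral:
  assumes f: "integrable \<mu> f" and x: "x \<in> G"
  shows "multiplier N c f x = (\<integral>t. cnj (\<Sum>v<N. of_real (c v) * \<psi> v t) * f (x \<oplus> t) \<partial>\<mu>)"
proof -
  have "integrable \<mu> (\<lambda>t. f (x \<oplus> t))"
    using integrable_translate[OF f x] by (simp add: add_commute)
  then have int: "integrable \<mu> (\<lambda>t. cnj (\<psi> v t) * f (x \<oplus> t))" for v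
    using integrable_mult_cnj_psi[of "\<lambda>t. f (x \<oplus> t)" v] by (simp add: mult.commute)
  have "multiplier N c f x = (\<Sum>v<N. \<integral>t. of_real (c v) * (cnj (\<psi> v t) * f (x \<oplus> t)) \<partial>\<mu>)"
    by (simp add: multiplier_def fourier_mult_psi[OF f x])
  also have "\<dots> = (\<integral>t. (\<Sum>v<N. of_real (c v) * (cnj (\<psi> v t) * f (x \<oplus> t))) \<partial>\<mu>)"
    by (rule Bochner_Integration.integral_sum[symmetric]) (intro integrable_mult_right int)
  also have "\<dots> = (\<integral>t. cnj (\<Sum>v<N. of_real (c v) * \<psi> v t) * f (x \<oplus> t) \<partial>\<mu>)"
    by (simp add: sum_distrib_right mult.assoc)
  finally show ?thesis .
qed

lemma measurable_translate_pair:
  assumes "f \<in> borel_measurable \<mu>"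
  shows "(\<lambda>(x, t). f (x \<oplus> t)) \<in> borel_measurable (\<mu> \<Otimes>\<^sub>M \<mu>)"
  using measurable_compose[OF measurable_add_pair assms] by (simp add: case_prod_beta')

lemma lp_bound_multiplier:
  assumes p: "1 \<le> p" and f: "lp_bound p f B"
    and C: "(\<integral>x. norm (\<Sum>v<N. of_real (c v) * \<psi> v x) \<partial>\<mu>) \<le> C"
  shows "lp_bound p (multiplier N c f) (C * B)"
proof -
  define q where "q t = cnj (\<Sum>v<N. of_real (c v) * \<psi> v t)" for t
  have "lp_bound p (\<lambda>x. \<integral>t. q t * f (x \<oplus> t) \<partial>\<mu>) ((\<integral>t. norm (q t) \<partial>\<mu>) * B)"
  proof (rule lp_bound_integral[OF p])
    show "integrable \<mu> q" unfolding q_def by (intro integrable_cnj integrable_trig_poly)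
    show "0 \<le> B" using f by (rule lp_bound_nonneg)
    show "(\<lambda>(x, t). f (x \<oplus> t)) \<in> borel_measurable (\<mu> \<Otimes>\<^sub>M \<mu>)"
      using f by (intro measurable_translate_pair lp_bound_measurable)
    show "lp_bound p (\<lambda>x. f (x \<oplus> t)) B" if "t \<in> G" for t
      using f that by (rule lp_bound_translate)
  qed
  moreover have "(\<integral>t. norm (q t) \<partial>\<mu>) * B \<le> C * B"
    using C lp_bound_nonneg[OF f] unfolding q_def complex_mod_cnj by (rule mult_right_mono)
  ultimately have "lp_bound p (\<lambda>x. \<integral>t. q t * f (x \<oplus> t) \<partial>\<mu>) (C * B)"
    by (rule lp_bound_mono)
  then show ?thesis
    using lp_bound_cong[of "multiplier N c f" "\<lambda>x. \<integral>t. q t * f (x \<oplus> t) \<partial>\<mu>" p "C * B"]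
      multiplier_eq_integral[OF lp_bound_integrable[OF f p]]
    by (simp add: q_def)
qed

text \<open>\<open>f\<close> minus its partial sum of order \<open>M r\<close>, that is, minus its conditional expectation given the first
  \<open>r\<close> coordinates.\<close>

definition remainder :: "nat \<Rightarrow> ((nat \<Rightarrow> nat) \<Rightarrow> complex) \<Rightarrow> (nat \<Rightarrow> nat) \<Rightarrow> complex" where
  "remainder r f x = f x - multiplier (M r) (\<lambda>_. 1) f x"

text \<open>The Dirichlet kernel of order \<open>M r\<close> is a probability density supported on \<open>vilenkin_I m r\<close>, so the
  remainder is an average of the differences that the modulus of continuity bounds.\<close>

lemma lp_bound_remainder:
  assumes f: "f \<in> vilenkin_Lp m p" and p: "1 \<le> p"
  shows "lp_bound p (remainder r f) (vilenkin_modulus m p r f)"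
proof -
  obtain A where A: "lp_bound p f A" using vilenkin_Lp_lp_bound[OF f p] ..
  note int_f = lp_bound_integrable[OF A p]
  note [measurable] = lp_bound_measurable[OF A]
  define q where "q t = cnj (dirichlet r t)" for t
  have int_q: "integrable \<mu> q"
    using integrable_trig_poly[of "\<lambda>_. 1" "M r"]
    unfolding q_def dirichlet_def by (intro integrable_cnj) simp
  have "(\<lambda>_. 0) \<in> vilenkin_I m r"
    using zero_in_group by (simp add: vilenkin_I_def)
  then have mod0: "0 \<le> vilenkin_modulus m p r f"
    using lp_bound_modulus[OF f p] lp_bound_nonneg by blast
  have "lp_bound p (\<lambda>x. \<integral>t. q t * (f (x \<oplus> t) - f x) \<partial>\<mu>)
      ((\<integral>t. norm (q t) \<partial>\<mu>) * vilenkin_modulus m p r f)"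
  proof (rule lp_bound_integral[OF p int_q mod0])
    have [measurable]: "(\<lambda>z. f (fst z \<oplus> snd z)) \<in> borel_measurable (\<mu> \<Otimes>\<^sub>M \<mu>)"
      by (rule measurable_compose[OF measurable_add_pair]) measurable
    show "(\<lambda>(x, t). f (x \<oplus> t) - f x) \<in> borel_measurable (\<mu> \<Otimes>\<^sub>M \<mu>)"
      unfolding case_prod_beta' by measurable
    fix t assume "t \<in> G" "q t \<noteq> 0"
    then have "t \<in> vilenkin_I m r"
      using dirichlet_eq[of t r] by (auto simp: q_def vilenkin_I_def split: if_splits)
    then show "lp_bound p (\<lambda>x. f (x \<oplus> t) - f x) (vilenkin_modulus m p r f)"
      by (rule lp_bound_modulus[OF f p])
  qed
  then have *: "lp_bound p (\<lambda>x. - (\<integral>t. q t * (f (x \<oplus> t) - f x) \<partial>\<mu>)) (vilenkin_modulus m p r f)"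
    by (simp add: q_def integral_norm_dirichlet lp_bound_uminus)
  have "remainder r f x = - (\<integral>t. q t * (f (x \<oplus> t) - f x) \<partial>\<mu>)" if x: "x \<in> G" for x
  proof -
    have f_x: "integrable \<mu> (\<lambda>t. f (x \<oplus> t))"
      using integrable_translate[OF int_f x] by (simp add: add_commute)
    have "q t * f (x \<oplus> t) = (\<Sum>v<M r. f (x \<oplus> t) * cnj (\<psi> v t))" for t
      unfolding q_def dirichlet_def cnj_sum sum_distrib_right
      by (intro sum.cong) (simp_all add: mult.commute)
    then have int1: "integrable \<mu> (\<lambda>t. q t * f (x \<oplus> t))"
      using integrable_mult_cnj_psi[OF f_x] by (simp add: Bochner_Integration.integrable_sum)
    have "(\<integral>t. q t * (f (x \<oplus> t) - f x) \<partial>\<mu>) = (\<integral>t. q t * f (x \<oplus> t) \<partial>\<mu>) - (\<integral>t. q t * f x \<partial>\<mu>)"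
      using int1 int_q by (simp add: right_diff_distrib)
    also have "(\<integral>t. q t * f x \<partial>\<mu>) = cnj (\<integral>t. dirichlet r t \<partial>\<mu>) * f x"
      by (simp add: q_def)
    also have "\<dots> = f x"
      by (simp add: integral_dirichlet)
    also have "(\<integral>t. q t * f (x \<oplus> t) \<partial>\<mu>) = multiplier (M r) (\<lambda>_. 1) f x"
      by (simp add: multiplier_eq_integral[OF int_f x] q_def dirichlet_def)
    finally show ?thesis
      by (simp add: remainder_def)
  qed
  with * show ?thesis
    using lp_bound_cong[of "remainder r f" "\<lambda>x. - (\<integral>t. q t * (f (x \<oplus> t) - f x) \<partial>\<mu>)"] by simp
qed

lemma fourier_remainder:
  assumes f: "integrable \<mu> f"
  shows "vilenkin_fourier m (remainder r f) v = (if v < M r then 0 else vilenkin_fourier m f v)"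
proof -
  have "vilenkin_fourier m (remainder r f) v
      = (\<integral>x. f x * cnj (\<psi> v x) - (\<Sum>w<M r. vilenkin_fourier m f w * (\<psi> w x * cnj (\<psi> v x))) \<partial>\<mu>)"
    unfolding vilenkin_fourier_def[of m "remainder r f"] remainder_def multiplier_def
    by (simp add: left_diff_distrib sum_distrib_right mult.assoc)
  also have "\<dots> = vilenkin_fourier m f v
      - (\<Sum>w<M r. vilenkin_fourier m f w * (\<integral>x. \<psi> w x * cnj (\<psi> v x) \<partial>\<mu>))"
    using integrable_mult_cnj_psi[OF f]
    by (simp add: Bochner_Integration.integral_sum Bochner_Integration.integrable_sum
        vilenkin_fourier_def[of m f v])
  also have "(\<Sum>w<M r. vilenkin_fourier m f w * (\<integral>x. \<psi> w x * cnj (\<psi> v x) \<partial>\<mu>))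
      = (\<Sum>w<M r. if v = w then vilenkin_fourier m f v else 0)"
    by (intro sum.cong) (auto simp: psi_orthonormal)
  finally show ?thesis
    by (simp add: sum.delta)
qed

lemma multiplier_remainder:
  assumes f: "integrable \<mu> f" and "M r \<le> N"
  shows "multiplier N c (remainder r f) x
    = (\<Sum>v=M r..<N. of_real (c v) * (vilenkin_fourier m f v * \<psi> v x))"
proof -
  have "multiplier N c (remainder r f) x
      = (\<Sum>v<N. if v < M r then 0 else of_real (c v) * (vilenkin_fourier m f v * \<psi> v x))"
    unfolding multiplier_def by (intro sum.cong) (auto simp: fourier_remainder[OF f])
  also have "\<dots> = (\<Sum>v=M r..<N. if v < M r then 0 else of_real (c v) * (vilenkin_fourier m f v * \<psi> v x))"
    by (rule sum.mono_neutral_right) (auto simp: not_less)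
  also have "\<dots> = (\<Sum>v=M r..<N. of_real (c v) * (vilenkin_fourier m f v * \<psi> v x))"
    by (intro sum.cong) auto
  finally show ?thesis .
qed

lemma sum_shells:
  fixes g :: "nat \<Rightarrow> 'b::comm_monoid_add"
  shows "(\<Sum>r<K. \<Sum>v=M r..<M (Suc r). g v) = (\<Sum>v=1..<M K. g v)"
proof (induction K)
  case (Suc K)
  then show ?case
    using sum.atLeastLessThan_concat[of 1 "M K" "M (Suc K)" g] M_mono[of K "Suc K"] M_pos[of K]
    by simp
qed (simp add: vilenkin_M_rec)

text \<open>The terms with \<open>v \<ge> M (k - 1)\<close> are the mean of the remainder of order \<open>k - 1\<close>. For the others the
  partial sum of \<open>f\<close> is split off, which leaves the coefficients \<open>a v - 1\<close>, and the shell
  \<open>[M r, M (r + 1))\<close> is expressed through the remainder of order \<open>r\<close>. The frequency \<open>0\<close> lies in no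
  shell and drops out because \<open>a 0 = 1\<close>.\<close>

lemma cesaro_mean_minus_eq:
  assumes f: "integrable \<mu> f" and n: "n < M (Suc k)" and A: "cesaro_A \<beta> n \<noteq> 0"
  defines "a \<equiv> \<lambda>v. (if v \<le> n then cesaro_A \<beta> (n - v) else 0) / cesaro_A \<beta> n"
  shows "cesaro_mean m \<beta> n f x - f x
    = multiplier (M (Suc k)) a (remainder (k - 1) f) x
      + - remainder (k - 1) f x
      + (\<Sum>r<k - 1. multiplier (M (Suc r)) (\<lambda>v. a v - 1) (remainder r f) x)"
proof -
  define e where "e v = vilenkin_fourier m f v * \<psi> v x" for v
  let ?K = "k - 1"
  have a0: "a 0 = 1" using A by (simp add: a_def)
  have "cesaro_mean m \<beta> n f x = (\<Sum>v\<le>n. of_real (a v) * e v)"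
    unfolding cesaro_mean_def sum_divide_distrib by (intro sum.cong) (auto simp: a_def e_def)
  also have "\<dots> = (\<Sum>v<M (Suc k). of_real (a v) * e v)"
    using n by (intro sum.mono_neutral_left) (auto simp: a_def)
  also have "\<dots> = (\<Sum>v<M ?K. of_real (a v) * e v) + (\<Sum>v=M ?K..<M (Suc k). of_real (a v) * e v)"
    using M_mono[of ?K "Suc k"] by (simp add: lessThan_atLeast0 sum.atLeastLessThan_concat)
  also have "(\<Sum>v<M ?K. of_real (a v) * e v) = (\<Sum>v<M ?K. e v) + (\<Sum>v<M ?K. of_real (a v - 1) * e v)"
    by (simp add: sum.distrib[symmetric] algebra_simps)
  also have "(\<Sum>v<M ?K. of_real (a v - 1) * e v) = (\<Sum>v=1..<M ?K. of_real (a v - 1) * e v)"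
    by (rule sum.mono_neutral_right) (auto simp: a0 not_le less_Suc_eq)
  also have "\<dots> = (\<Sum>r<?K. \<Sum>v=M r..<M (Suc r). of_real (a v - 1) * e v)"
    by (rule sum_shells[symmetric])
  also have "\<dots> = (\<Sum>r<?K. multiplier (M (Suc r)) (\<lambda>v. a v - 1) (remainder r f) x)"
    by (intro sum.cong refl) (simp only: multiplier_remainder[OF f M_mono] e_def le_SucI order_refl)
  also have "(\<Sum>v=M ?K..<M (Suc k). of_real (a v) * e v)
      = multiplier (M (Suc k)) a (remainder ?K f) x"
    using M_mono[of ?K "Suc k"] by (simp add: multiplier_remainder[OF f] e_def)
  finally have "cesaro_mean m \<beta> n f x = (\<Sum>v<M ?K. e v)
      + (\<Sum>r<?K. multiplier (M (Suc r)) (\<lambda>v. a v - 1) (remainder r f) x)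
      + multiplier (M (Suc k)) a (remainder ?K f) x" .
  moreover have "remainder ?K f x = f x - (\<Sum>v<M ?K. e v)"
    by (simp add: remainder_def multiplier_def e_def)
  ultimately show ?thesis
    by (simp only:) (simp add: algebra_simps)
qed

text \<open>The constants are not optimised. \<open>C\<^sub>1\<close> bounds the norm of the mean divided by \<open>(M k) powr \<alpha>\<close>; the
  \<open>1\<close> accounts for the remainder itself, because \<open>(M k) powr \<alpha> \<ge> 1\<close>; and \<open>C\<^sub>2\<close> belongs to the shells.\<close>

theorem cesaro_approximation:
  fixes \<alpha> :: real and p :: ennreal
  assumes \<alpha>: "0 < \<alpha>" "\<alpha> < 1" and b: "\<And>k. m k \<le> b" and p: "1 \<le> p"
    and f: "f \<in> vilenkin_Lp m p" and k: "1 \<le> k" and n: "M k \<le> n" "n < M (Suc k)"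
  defines "C\<^sub>1 \<equiv> real b / (1 - \<alpha>) * (1 + sqrt (2 * real b) / (1 - 2 powr (-\<alpha>)))"
    and "C\<^sub>2 \<equiv> 4 * (real b)\<^sup>2 / (1 - sqrt (1 / 2))"
  shows "vilenkin_norm m p (\<lambda>x. cesaro_mean m (-\<alpha>) n f x - f x)
    \<le> (C\<^sub>1 + 1 + C\<^sub>2) * (real (M k) powr \<alpha> * vilenkin_modulus m p (k - 1) f
        + (\<Sum>r<k - 1. real (M r) / real (M k) * vilenkin_modulus m p r f))"
proof -
  let ?A = "cesaro_A (-\<alpha>)" and ?\<omega> = "\<lambda>r. vilenkin_modulus m p r f"
  note A_pos = cesaro_A_pos[OF \<alpha>] and A_anti = cesaro_A_antimono[OF \<alpha>]
  define a where "a v = (if v \<le> n then ?A (n - v) else 0) / ?A n" for v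
  obtain B where B: "lp_bound p f B" using vilenkin_Lp_lp_bound[OF f p] ..
  note int_f = lp_bound_integrable[OF B p]
  note rem = lp_bound_remainder[OF f p]
  have \<omega>_nonneg: "0 \<le> ?\<omega> r" for r using rem by (rule lp_bound_nonneg)
  have n1: "1 \<le> n" using n M_pos[of k] by linarith
  have b1: "1 \<le> real b" using m_ge_2[of 0] b[of 0] by linarith
  have Mk1: "1 \<le> real (M k) powr \<alpha>"
    using \<alpha> M_pos[of k] by (intro ge_one_powr_ge_zero) (auto simp: Suc_le_eq)
  have n_powr: "real n powr \<alpha> \<le> real b * real (M k) powr \<alpha>"
  proof -
    have "n \<le> b * M k"
      using n b[of k] by (simp add: vilenkin_M_rec) (meson less_imp_le mult_le_mono1 order_trans)
    then have "real n powr \<alpha> \<le> (real b * real (M k)) powr \<alpha>"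
      using \<alpha> by (intro powr_mono2) (auto simp flip: of_nat_mult)
    also have "\<dots> = real b powr \<alpha> * real (M k) powr \<alpha>"
      by (simp add: powr_mult)
    also have "real b powr \<alpha> \<le> real b powr 1"
      using \<alpha> b1 by (intro powr_mono) auto
    finally show ?thesis
      using b1 by (simp add: mult_right_mono)
  qed
  define C where "C = 1 + sqrt (2 * real b) / (1 - 2 powr (-\<alpha>))"
  have C0: "0 \<le> C"
    using \<alpha> powr_less_one[of 2 "-\<alpha>"] by (simp add: C_def)
  have kernel_a: "(\<integral>x. norm (\<Sum>v<M (Suc k). of_real (a v) * \<psi> v x) \<partial>\<mu>) \<le> C\<^sub>1 * real (M k) powr \<alpha>"
  proof -
    have "(\<Sum>v<M (Suc k). of_real (a v) * \<psi> v x)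
        = of_real (1 / ?A n) * (\<Sum>v<M (Suc k). of_real (if v \<le> n then ?A (n - v) else 0) * \<psi> v x)" for x
      unfolding sum_distrib_left by (intro sum.cong) (auto simp: a_def)
    then have "(\<integral>x. norm (\<Sum>v<M (Suc k). of_real (a v) * \<psi> v x) \<partial>\<mu>)
        = 1 / ?A n * (\<integral>x. norm (\<Sum>v<M (Suc k). of_real (if v \<le> n then ?A (n - v) else 0) * \<psi> v x) \<partial>\<mu>)"
      using A_pos[of n] by (simp add: norm_mult del: of_real_divide)
    also have "\<dots> \<le> (real n powr \<alpha> / (1 - \<alpha>)) * C"
      unfolding C_def
      by (intro mult_mono inverse_cesaro_A_le[OF \<alpha> n1] cesaro_kernel_L1[OF \<alpha> b]) (use \<alpha> in auto)
    also have "\<dots> \<le> (real b * real (M k) powr \<alpha> / (1 - \<alpha>)) * C"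
      using n_powr C0 \<alpha> by (intro mult_right_mono divide_right_mono) auto
    also have "\<dots> = C\<^sub>1 * real (M k) powr \<alpha>"
      by (simp add: C\<^sub>1_def C_def)
    finally show ?thesis .
  qed
  have sqrt_half: "0 < 1 - sqrt (1 / 2)"
    by (simp add: real_sqrt_lt_1_iff)
  have kernel_c: "(\<integral>x. norm (\<Sum>v<M (Suc r). of_real (a v - 1) * \<psi> v x) \<partial>\<mu>)
      \<le> C\<^sub>2 * (real (M r) / real (M k))" if r: "r < k - 1" for r
  proof -
    have lip: "\<bar>(a w - 1) - (a v - 1)\<bar> \<le> 4 / real (M k) * real (w - v)"
      if "v \<le> w" "w < M (Suc r)" for v w
    proof -
      \<comment> \<open>\<open>M (r + 1) \<le> M (k - 1) \<le> M k / 2\<close>, which puts all frequencies of the shell below \<open>n / 2\<close>\<close>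
      have "2 * M (Suc r) \<le> M (Suc r) * 2 ^ (k - Suc r)"
        using r by (cases "k - Suc r") auto
      also have "\<dots> \<le> M k"
        using M_growth[of "Suc r" "k - Suc r"] r by simp
      finally have w: "2 * w \<le> n" using that n by linarith
      then have "v \<le> n" "w \<le> n" using that by auto
      then have "0 \<le> a w - a v"
        using A_anti[of "n - w" "n - v"] A_pos[of n] that by (simp add: a_def divide_right_mono)
      moreover have "a w - a v \<le> 4 * real (w - v) / real n"
        using cesaro_A_ratio_lipschitz[OF \<alpha> that(1) w n1] \<open>v \<le> n\<close> \<open>w \<le> n\<close> by (simp add: a_def)
      moreover have "4 * real (w - v) / real n \<le> 4 * real (w - v) / real (M k)"
        using n n1 by (intro divide_left_mono mult_pos_pos) auto
      ultimately show ?thesis by simp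
    qed
    have "(\<integral>x. norm (\<Sum>v<M (Suc r). of_real (a v - 1) * \<psi> v x) \<partial>\<mu>)
        \<le> real b * (4 / real (M k)) / (1 - sqrt (1 / 2)) * real (M (Suc r))"
      using lip A_pos[of n]
      by (intro lipschitz_multiplier_L1[where c = "\<lambda>v. a v - 1", OF b]) (auto simp: a_def)
    also have "\<dots> \<le> real b * (4 / real (M k)) / (1 - sqrt (1 / 2)) * (real b * real (M r))"
      using b[of r] sqrt_half by (intro mult_left_mono) (auto simp: vilenkin_M_rec mult_right_mono)
    also have "\<dots> = C\<^sub>2 * (real (M r) / real (M k))"
      by (simp add: C\<^sub>2_def power2_eq_square mult_ac)
    finally show ?thesis .
  qed
  let ?bound = "C\<^sub>1 * real (M k) powr \<alpha> * ?\<omega> (k - 1) + ?\<omega> (k - 1)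
      + (\<Sum>r<k - 1. C\<^sub>2 * (real (M r) / real (M k)) * ?\<omega> r)"
  have "lp_bound p (\<lambda>x. multiplier (M (Suc k)) a (remainder (k - 1) f) x
      + - remainder (k - 1) f x
      + (\<Sum>r<k - 1. multiplier (M (Suc r)) (\<lambda>v. a v - 1) (remainder r f) x)) ?bound"
    by (intro lp_bound_add lp_bound_sum lp_bound_multiplier lp_bound_uminus rem p kernel_a kernel_c)
      auto
  then have "vilenkin_norm m p (\<lambda>x. cesaro_mean m (-\<alpha>) n f x - f x) \<le> ?bound"
    using A_pos[of n] unfolding a_def
    by (subst cesaro_mean_minus_eq[OF int_f n(2)]) (auto intro: vilenkin_norm_le[OF _ p])
  also have "\<dots> \<le> (C\<^sub>1 + 1 + C\<^sub>2) * (real (M k) powr \<alpha> * ?\<omega> (k - 1))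
      + (C\<^sub>1 + 1 + C\<^sub>2) * (\<Sum>r<k - 1. real (M r) / real (M k) * ?\<omega> r)"
  proof (rule add_mono)
    have C1: "0 \<le> C\<^sub>1" "0 \<le> C\<^sub>2"
      using C0 b1 \<alpha> sqrt_half by (simp_all add: C\<^sub>1_def C\<^sub>2_def C_def[symmetric])
    define T where "T = real (M k) powr \<alpha> * ?\<omega> (k - 1)"
    have "?\<omega> (k - 1) \<le> T"
      using mult_right_mono[OF Mk1 \<omega>_nonneg[of "k - 1"]] by (simp add: T_def)
    moreover have "0 \<le> C\<^sub>2 * T"
      using C1 \<omega>_nonneg by (simp add: T_def)
    ultimately have "C\<^sub>1 * T + ?\<omega> (k - 1) \<le> (C\<^sub>1 + 1 + C\<^sub>2) * T"
      by (simp add: distrib_right)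
    then show "C\<^sub>1 * real (M k) powr \<alpha> * ?\<omega> (k - 1) + ?\<omega> (k - 1)
        \<le> (C\<^sub>1 + 1 + C\<^sub>2) * (real (M k) powr \<alpha> * ?\<omega> (k - 1))"
      by (simp add: T_def mult.assoc)
    have "(\<Sum>r<k - 1. C\<^sub>2 * (real (M r) / real (M k)) * ?\<omega> r)
        = C\<^sub>2 * (\<Sum>r<k - 1. real (M r) / real (M k) * ?\<omega> r)"
      by (simp add: sum_distrib_left mult.assoc)
    also have "\<dots> \<le> (C\<^sub>1 + 1 + C\<^sub>2) * (\<Sum>r<k - 1. real (M r) / real (M k) * ?\<omega> r)"
      using C1 \<omega>_nonneg by (intro mult_right_mono sum_nonneg) auto
    finally show "(\<Sum>r<k - 1. C\<^sub>2 * (real (M r) / real (M k)) * ?\<omega> r)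
        \<le> (C\<^sub>1 + 1 + C\<^sub>2) * (\<Sum>r<k - 1. real (M r) / real (M k) * ?\<omega> r)" .
  qed
  finally show ?thesis
    by (simp add: distrib_left)
qed

end

theorem theorem1:
  fixes m :: "nat \<Rightarrow> nat" and p :: ennreal and \<alpha> :: real
  assumes "\<And>k. 2 \<le> m k" and "bdd_above (range m)"
    and "1 \<le> p"
    and "0 < \<alpha>" and "\<alpha> < 1"
  shows "\<exists>c::real. \<forall>f \<in> vilenkin_Lp m p. \<forall>k n :: nat.
           1 \<le> k \<longrightarrow> vilenkin_M m k \<le> n \<longrightarrow> n < vilenkin_M m (k + 1) \<longrightarrow>
           vilenkin_norm m p (\<lambda>x. cesaro_mean m (- \<alpha>) n f x - f x)
             \<le> c * (real (vilenkin_M m k) powr \<alpha> * vilenkin_modulus m p (k - 1) f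
                    + (\<Sum>r<k - 1. real (vilenkin_M m r) / real (vilenkin_M m k)
                                    * vilenkin_modulus m p r f))"
proof -
  interpret vilenkin m
    by unfold_locales (rule assms(1))
  obtain b where b: "\<And>k. m k \<le> b"
    using assms(2) by (auto simp: bdd_above_def)
  show ?thesis
    using cesaro_approximation[OF assms(4,5) b assms(3)] by (intro exI ballI allI impI) simp
qed

end
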